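(* Let $G$ be a finite group with exactly $n$ distinct centralizers, where $n\le 21$, i.e. $|\mathcal{C}(G)|=n\le 21$. Then $G$ is soluble. Moreover, the alternating group $A_5$ of degree $5$ satisfies $|\mathcal{C}(A_5)|=22$, so the bound $21$ cannot be increased.
   Context: For a group $G$, $\mathcal{C}(G)=\{C_G(x) : x\in G\}$ denotes the set of centralizers of elements of $G$, where $C_G(x)=\{g\in G: gx=xg\}$. A group $G$ is called a $\mathcal{C}_n$-group if $|\mathcal{C}(G)|=n$. *)

theory Defs
  imports "HOL-Algebra.Solvable_Groups" "HOL-Algebra.Sym_Groups"
begin

definition centralizer :: "('a, 'b) monoid_scheme \<Rightarrow> 'a \<Rightarrow> 'a set" where
  "centralizer G x = {g \<in> carrier G. g \<otimes>\<^bsub>G\<^esub> x = x \<otimes>\<^bsub>G\<^esub> g}"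

definition centralizers :: "('a, 'b) monoid_scheme \<Rightarrow> 'a set set" where
  "centralizers G = centralizer G ` carrier G"

end

theory Submission
  imports Defs "HOL-Algebra.Sylow" "HOL-Algebra.SimpleGroups" "HOL-Algebra.Multiplicative_Group" "HOL-Number_Theory.Cong"
begin

text \<open>The centres of the proper centralizers form a conjugation-invariant family of abelian
  subgroups covering \<open>G\<close>, and such a family induces one on every section of \<open>G\<close>. A non-soluble
  group has a non-abelian simple section \<open>S\<close>, so it suffices to show that \<open>S\<close> is not covered by a
  conjugation-invariant family of 20 abelian subgroups. Every nontrivial conjugation orbit of
  subsets of \<open>S\<close> has at least 5 members and an orbit of size \<open>m\<close> embeds \<open>S\<close> into the alternating
  group of degree \<open>m\<close>; hence there are at most 4 orbits, and three or four orbits force one of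
  size 5 or 6 and thus a very restricted order. If a prime \<open>p\<close> divides \<open>|S|\<close> exactly once, then
  some orbit has a size with a divisor \<open>d \<ge> 5\<close>, \<open>d \<equiv> 1 (mod p)\<close>: for \<open>A\<^sub>5\<close> this yields the orbit
  sizes \<open>5 + 10 + 6 = 21\<close>. With two orbits, counting shows that one of the abelian subgroups is a
  Frobenius complement of index at most 15, which is excluded by counting Sylow subgroups in the
  complement of the union of its conjugates.\<close>


section \<open>Conjugation of subsets\<close>

text \<open>The number of centralizers does not itself pass to sections, since a centralizer in a
  quotient need not be the image of one. What survives intersection with a subgroup and passage to a
  quotient is an invariant family of abelian subgroups that covers; this is why centralizers are
  replaced by their centres. The family has at most 20 members rather than 21 because
  \<open>G\<close> is itself a centralizer, that of the identity, and its centre lies in the centre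
  of every other centralizer. No classification of simple groups of small order enters: with three
  or four orbits an embedding into an alternating group of degree 5 or 6 already bounds the order.
  With two orbits the sizes can reach 15, where such an embedding says little, and counting elements
  takes its place. The sharpness claim uses the same lower bound: \<open>A\<^sub>5\<close> is not
  soluble and so has at least 22 centralizers, and only the opposite inequality is computed.\<close>

context group
begin

definition conj_set :: "'a \<Rightarrow> 'a set \<Rightarrow> 'a set" where
  "conj_set g B = (\<lambda>x. g \<otimes> x \<otimes> inv g) ` B"

definition conj_orbit :: "'a set \<Rightarrow> 'a set \<Rightarrow> 'a set set" where
  "conj_orbit H B = (\<lambda>g. conj_set g B) ` H"

text \<open>The normalizer of \<open>B\<close> in \<open>H\<close> if \<open>B\<close> is a
  subgroup, and the centralizer of \<open>x\<close> in \<open>H\<close> if \<open>B = {x}\<close>.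
  One action on subsets thus covers subgroups and elements alike.\<close>

definition conj_stab :: "'a set \<Rightarrow> 'a set \<Rightarrow> 'a set" where
  "conj_stab H B = {g \<in> H. conj_set g B = B}"

lemma conj_set_closed: "g \<in> carrier G \<Longrightarrow> B \<subseteq> carrier G \<Longrightarrow> conj_set g B \<subseteq> carrier G"
  by (auto simp: conj_set_def)

lemma conj_set_one: "B \<subseteq> carrier G \<Longrightarrow> conj_set \<one> B = B"
  by (force simp: conj_set_def image_iff subset_iff)

lemma conj_elem_mult:
  "\<lbrakk>g \<in> carrier G; h \<in> carrier G; x \<in> carrier G\<rbrakk> \<Longrightarrow>
     g \<otimes> (h \<otimes> x \<otimes> inv h) \<otimes> inv g = (g \<otimes> h) \<otimes> x \<otimes> inv (g \<otimes> h)"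
  by (simp add: inv_mult_group m_assoc)

lemma conj_set_mult:
  assumes "g \<in> carrier G" "h \<in> carrier G" "B \<subseteq> carrier G"
  shows "conj_set g (conj_set h B) = conj_set (g \<otimes> h) B"
  unfolding conj_set_def image_image
  using assms conj_elem_mult by (intro image_cong refl) (auto simp: subset_iff)

lemma conj_set_inv:
  assumes "g \<in> carrier G" "B \<subseteq> carrier G"
  shows "conj_set (inv g) (conj_set g B) = B" "conj_set g (conj_set (inv g) B) = B"
  using assms by (simp_all add: conj_set_mult conj_set_one)

lemma conj_set_mono: "B \<subseteq> C \<Longrightarrow> conj_set g B \<subseteq> conj_set g C"
  by (auto simp: conj_set_def)

lemma conj_elem_inj:
  assumes "g \<in> carrier G" "B \<subseteq> carrier G"
  shows "inj_on (\<lambda>x. g \<otimes> x \<otimes> inv g) B"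
  using assms by (auto intro!: inj_onI simp: subset_iff)

lemma card_conj_set:
  "g \<in> carrier G \<Longrightarrow> B \<subseteq> carrier G \<Longrightarrow> card (conj_set g B) = card B"
  unfolding conj_set_def by (rule card_image[OF conj_elem_inj])

lemma conj_set_subgroup:
  assumes "g \<in> carrier G" "subgroup H G"
  shows "subgroup (conj_set g H) G"
proof (rule subgroupI)
  note sub = subgroup.mem_carrier[OF assms(2)]
  show "conj_set g H \<subseteq> carrier G"
    using assms subgroup.subset by (intro conj_set_closed)
  show "conj_set g H \<noteq> {}"
    using subgroup.one_closed[OF assms(2)] by (auto simp: conj_set_def)
  show "inv a \<in> conj_set g H" if "a \<in> conj_set g H" for a
  proof -
    from that obtain x where x: "x \<in> H" "a = g \<otimes> x \<otimes> inv g" by (auto simp: conj_set_def)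
    then have "inv a = g \<otimes> inv x \<otimes> inv g"
      using assms(1) sub by (simp add: inv_mult_group m_assoc)
    then show ?thesis using x subgroup.m_inv_closed[OF assms(2)] by (auto simp: conj_set_def)
  qed
  show "a \<otimes> b \<in> conj_set g H" if "a \<in> conj_set g H" "b \<in> conj_set g H" for a b
  proof -
    from that obtain x y where x: "x \<in> H" "a = g \<otimes> x \<otimes> inv g" and y: "y \<in> H" "b = g \<otimes> y \<otimes> inv g"
      by (auto simp: conj_set_def)
    moreover have "inv g \<otimes> (g \<otimes> (y \<otimes> inv g)) = y \<otimes> inv g"
      using y assms(1) sub by (simp add: m_assoc[symmetric])
    ultimately have "a \<otimes> b = g \<otimes> (x \<otimes> y) \<otimes> inv g"
      using assms(1) sub by (simp add: m_assoc)
    then show ?thesis using x y subgroup.m_closed[OF assms(2)] by (auto simp: conj_set_def)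
  qed
qed

lemma conj_set_Int:
  assumes "g \<in> carrier G" "A \<subseteq> carrier G" "B \<subseteq> carrier G"
  shows "conj_set g (A \<inter> B) = conj_set g A \<inter> conj_set g B"
  unfolding conj_set_def
  using inj_on_image_Int[OF conj_elem_inj[OF assms(1) order.refl] assms(2,3)] .

lemma conj_set_trivial: "g \<in> carrier G \<Longrightarrow> conj_set g {\<one>} = {\<one>}"
  by (simp add: conj_set_def)

lemma conj_orbit_subset: 
  "H \<subseteq> carrier G \<Longrightarrow> B \<subseteq> carrier G \<Longrightarrow> C \<in> conj_orbit H B \<Longrightarrow> C \<subseteq> carrier G"
  unfolding conj_orbit_def using conj_set_closed by blast

lemma conj_orbit_self: "subgroup H G \<Longrightarrow> B \<subseteq> carrier G \<Longrightarrow> B \<in> conj_orbit H B"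
  unfolding conj_orbit_def by (rule image_eqI[of _ _ \<one>]) (simp_all add: conj_set_one subgroup.one_closed)

lemma conj_orbit_closed:
  assumes "subgroup H G" "B \<subseteq> carrier G" "C \<in> conj_orbit H B" "h \<in> H"
  shows "conj_set h C \<in> conj_orbit H B"
proof -
  from assms(3) obtain g where g: "g \<in> H" "C = conj_set g B" by (auto simp: conj_orbit_def)
  then have "conj_set h C = conj_set (h \<otimes> g) B"
    using assms subgroup.mem_carrier[OF assms(1)] by (simp add: conj_set_mult)
  then show ?thesis
    using g assms(4) subgroup.m_closed[OF assms(1)] by (auto simp: conj_orbit_def)
qed

lemma conj_orbit_sym:
  assumes "subgroup H G" "B \<subseteq> carrier G" "C \<in> conj_orbit H B"
  shows "B \<in> conj_orbit H C"
proof -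
  from assms(3) obtain g where g: "g \<in> H" "C = conj_set g B" by (auto simp: conj_orbit_def)
  then have "B = conj_set (inv g) C"
    using assms subgroup.mem_carrier[OF assms(1)] by (simp add: conj_set_inv)
  then show ?thesis using g subgroup.m_inv_closed[OF assms(1)] by (auto simp: conj_orbit_def)
qed

lemma conj_stab_subgroup:
  assumes "subgroup H G" "B \<subseteq> carrier G"
  shows "subgroup (conj_stab H B) G"
proof (rule subgroupI)
  note sub = subgroup.mem_carrier[OF assms(1)]
  show "conj_stab H B \<subseteq> carrier G" using sub by (auto simp: conj_stab_def)
  show "conj_stab H B \<noteq> {}"
    using conj_set_one[OF assms(2)] subgroup.one_closed[OF assms(1)] by (auto simp: conj_stab_def)
  show "inv a \<in> conj_stab H B" if "a \<in> conj_stab H B" for a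
    using that assms sub subgroup.m_inv_closed[OF assms(1)] conj_set_inv(1)[of a B]
    by (auto simp: conj_stab_def)
  show "a \<otimes> b \<in> conj_stab H B" if "a \<in> conj_stab H B" "b \<in> conj_stab H B" for a b
    using that assms sub subgroup.m_closed[OF assms(1)] conj_set_mult[of a b B, symmetric]
    by (auto simp: conj_stab_def)
qed

text \<open>The elements of \<open>H\<close> that send \<open>B\<close> to a given member of its
  orbit form a left coset of the stabilizer, so all fibres have the same size.\<close>

lemma conj_orbit_stabilizer:
  assumes "subgroup H G" "finite H" "B \<subseteq> carrier G"
  shows "card (conj_orbit H B) * card (conj_stab H B) = card H"
proof -
  note sub = subgroup.mem_carrier[OF assms(1)]
  have fib: "card {h \<in> H. conj_set h B = C} = card (conj_stab H B)" if C: "C \<in> conj_orbit H B" for C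
  proof -
    from C obtain g where g: "g \<in> H" "C = conj_set g B" by (auto simp: conj_orbit_def)
    have "{h \<in> H. conj_set h B = C} = (\<lambda>s. g \<otimes> s) ` conj_stab H B"
    proof (intro equalityI subsetI)
      fix h assume "h \<in> {h \<in> H. conj_set h B = C}"
      then have h: "h \<in> H" "conj_set h B = conj_set g B" using g by auto
      have "conj_set (inv g \<otimes> h) B = conj_set (inv g) (conj_set h B)"
        using g h(1) sub assms(3) by (intro conj_set_mult[symmetric]) auto
      then have "conj_set (inv g \<otimes> h) B = B"
        using g h sub assms(3) by (simp add: conj_set_inv)
      then have "inv g \<otimes> h \<in> conj_stab H B"
        using g h subgroup.m_closed[OF assms(1)] subgroup.m_inv_closed[OF assms(1)]
        by (auto simp: conj_stab_def)
      moreover have "h = g \<otimes> (inv g \<otimes> h)"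
        using g h sub by (simp add: m_assoc[symmetric])
      ultimately show "h \<in> (\<lambda>s. g \<otimes> s) ` conj_stab H B" by blast
    next
      fix h assume "h \<in> (\<lambda>s. g \<otimes> s) ` conj_stab H B"
      then show "h \<in> {h \<in> H. conj_set h B = C}"
        using g assms(3) subgroup.m_closed[OF assms(1)] sub
        by (auto simp: conj_stab_def conj_set_mult[symmetric])
    qed
    moreover have "inj_on (\<lambda>s. g \<otimes> s) (conj_stab H B)"
      using g sub by (auto intro!: inj_onI simp: conj_stab_def)
    ultimately show ?thesis by (simp add: card_image)
  qed
  have "card H = (\<Sum>C\<in>conj_orbit H B. card {h \<in> H. conj_set h B = C})"
    using assms(2) sum.group[of H "conj_orbit H B" "\<lambda>h. conj_set h B" "\<lambda>_. 1::nat"]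
    by (simp add: conj_orbit_def)
  also have "\<dots> = card (conj_orbit H B) * card (conj_stab H B)"
    using fib by simp
  finally show ?thesis by simp
qed

lemma conj_orbit_trivial_iff:
  assumes "subgroup H G" "B \<subseteq> carrier G"
  shows "card (conj_orbit H B) = 1 \<longleftrightarrow> (\<forall>h\<in>H. conj_set h B = B)"
proof
  assume "card (conj_orbit H B) = 1"
  then obtain C where "conj_orbit H B = {C}" by (auto simp: card_1_singleton_iff)
  then show "\<forall>h\<in>H. conj_set h B = B"
    using conj_orbit_self[OF assms] by (auto simp: conj_orbit_def)
next
  assume "\<forall>h\<in>H. conj_set h B = B"
  then have "conj_orbit H B = {B}"
    using subgroup.one_closed[OF assms(1)] by (auto simp: conj_orbit_def)
  then show "card (conj_orbit H B) = 1" by simp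
qed

lemma conj_orbit_disjoint:
  assumes "subgroup H G" "B \<subseteq> carrier G" "C \<notin> conj_orbit H B" "C \<subseteq> carrier G" "h \<in> H"
  shows "conj_set h C \<notin> conj_orbit H B"
proof
  note sub = subgroup.mem_carrier[OF assms(1)]
  assume "conj_set h C \<in> conj_orbit H B"
  then have "conj_set (inv h) (conj_set h C) \<in> conj_orbit H B"
    using conj_orbit_closed[OF assms(1,2)] assms(5) subgroup.m_inv_closed[OF assms(1)] by blast
  then show False using assms sub by (simp add: conj_set_inv)
qed

text \<open>Orbits of a \<open>p\<close>-group have size 1 or a multiple of \<open>p\<close>, and an
  orbit with a fixed member is a singleton. The induction peels off one orbit at a time.\<close>

lemma card_fixed_points_cong:
  assumes "subgroup P G" "finite P" "card P = p ^ e" "prime (p::nat)"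
    and "finite X" "X \<subseteq> Pow (carrier G)" "\<And>g B. g \<in> P \<Longrightarrow> B \<in> X \<Longrightarrow> conj_set g B \<in> X"
  shows "[card X = card {B \<in> X. \<forall>g\<in>P. conj_set g B = B}] (mod p)"
  using assms(5-7)
proof (induction X rule: finite_psubset_induct)
  case (psubset X)
  let ?fix = "\<lambda>X. {B \<in> X. \<forall>g\<in>P. conj_set g B = B}"
  show ?case
  proof (cases "X = {}")
    case True then show ?thesis by simp
  next
    case False
    then obtain B where B: "B \<in> X" by auto
    then have Bc: "B \<subseteq> carrier G" using psubset by auto
    let ?O = "conj_orbit P B"
    have OX: "?O \<subseteq> X" using psubset(4) B by (auto simp: conj_orbit_def)
    have BO: "B \<in> ?O" using conj_orbit_self[OF assms(1) Bc] .
    have fO: "finite ?O" using OX psubset(1) finite_subset by blast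
    have IH: "[card (X - ?O) = card (?fix (X - ?O))] (mod p)"
    proof (rule psubset.IH)
      show "X - ?O \<subset> X" using BO B by blast
      show "X - ?O \<subseteq> Pow (carrier G)" using psubset.prems by auto
      show "conj_set g C \<in> X - ?O" if "g \<in> P" "C \<in> X - ?O" for g C
        using that psubset.prems conj_orbit_disjoint[OF assms(1) Bc] by blast
    qed
    have cX: "card X = card (X - ?O) + card ?O"
      using OX fO psubset(1) by (metis card_Diff_subset card_mono le_add_diff_inverse2)
    have "?fix X = ?fix (X - ?O) \<union> ?fix ?O" using OX by blast
    then have cF: "card (?fix X) = card (?fix (X - ?O)) + card (?fix ?O)"
      using fO psubset(1) by (simp add: card_Un_disjoint disjoint_iff)
    have "[card ?O = card (?fix ?O)] (mod p)"
    proof (cases "card ?O = 1")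
      case True
      then obtain C where "?O = {C}" by (auto simp: card_1_singleton_iff)
      moreover from this have "?fix ?O = ?O"
        using BO True conj_orbit_trivial_iff[OF assms(1) Bc] by auto
      ultimately show ?thesis by simp
    next
      case False
      have "card ?O dvd p ^ e"
        using conj_orbit_stabilizer[OF assms(1,2) Bc] assms(3) by (metis dvd_triv_left)
      then obtain i where "card ?O = p ^ i" using assms(4) by (auto simp: divides_primepow_nat)
      then have pd: "p dvd card ?O" using False by (cases i) auto
      have "?fix ?O = {}"
      proof (rule ccontr)
        assume "?fix ?O \<noteq> {}"
        then obtain C where C: "C \<in> ?O" "\<forall>g\<in>P. conj_set g C = C" by auto
        then have "B \<in> conj_orbit P C" using conj_orbit_sym[OF assms(1) Bc] by auto
        then have "B = C" using C by (auto simp: conj_orbit_def)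
        then show False using C conj_orbit_trivial_iff[OF assms(1) Bc] False by auto
      qed
      then have "card (?fix ?O) = 0" by (simp only: card.empty)
      then show ?thesis using pd by (simp add: cong_0_iff)
    qed
    then show ?thesis unfolding cX cF using IH by (rule cong_add[rotated])
  qed
qed

section \<open>Divisibility of orbit sizes, and Sylow subgroups\<close>

text \<open>Orbit sizes are indices of stabilizers, and the index of the larger stabilizer divides
  that of the smaller one.\<close>

lemma card_conj_orbit_dvd:
  assumes "finite (carrier G)" "B \<subseteq> carrier G" "C \<subseteq> carrier G"
    and "conj_stab (carrier G) B \<subseteq> conj_stab (carrier G) C"
  shows "card (conj_orbit (carrier G) C) dvd card (conj_orbit (carrier G) B)"
proof -
  let ?B = "conj_stab (carrier G) B" and ?C = "conj_stab (carrier G) C"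
  have sB: "subgroup ?B G" and sC: "subgroup ?C G"
    using assms conj_stab_subgroup subgroup_self by auto
  have "subgroup ?B (G\<lparr>carrier := ?C\<rparr>)" using subgroup_incl[OF sB sC assms(4)] .
  then have "card ?B dvd card ?C"
    using group.lagrange[OF subgroup_imp_group[OF sC], of ?B]
    by (metis dvd_triv_right order_def partial_object.simps(1) partial_object.surjective partial_object.update_convs(1))
  moreover have "card ?B > 0" "card ?C > 0"
    using assms(1) sB sC subgroup.finite_imp_card_positive by blast+
  moreover have "card (conj_orbit (carrier G) B) * card ?B = card (conj_orbit (carrier G) C) * card ?C"
    using conj_orbit_stabilizer[OF subgroup_self assms(1)] assms by simp
  ultimately show ?thesis
    by (auto elim!: dvdE)
qed

lemma card_conj_orbit_dvd_order:
  assumes "finite (carrier G)" "B \<subseteq> carrier G"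
  shows "card (conj_orbit (carrier G) B) dvd order G"
  using conj_orbit_stabilizer[OF subgroup_self assms] by (metis dvd_triv_left order_def)

lemma subgroup_subset_conj_stab:
  assumes "subgroup A G" shows "A \<subseteq> conj_stab (carrier G) A"
proof
  fix a assume a: "a \<in> A"
  interpret A: subgroup A G by fact
  have "conj_set a A \<subseteq> A" "conj_set (inv a) A \<subseteq> A" using a by (auto simp: conj_set_def)
  then have "conj_set a A = A"
    using conj_set_mono[of "conj_set (inv a) A" A a] a A.subset by (simp add: conj_set_inv)
  then show "a \<in> conj_stab (carrier G) A" using a by (auto simp: conj_stab_def)
qed

text \<open>The orbit size is the index of the normalizer of \<open>A\<close>, whose order is a
  multiple of \<open>card A\<close> because it contains \<open>A\<close>.\<close>

lemma card_conj_orbit_mult_dvd: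
  assumes "finite (carrier G)" "subgroup A G"
  shows "card (conj_orbit (carrier G) A) * card A dvd order G"
proof -
  let ?N = "conj_stab (carrier G) A"
  have "subgroup ?N G" using conj_stab_subgroup[OF subgroup_self] assms subgroup.subset by auto
  then have "card A dvd card ?N"
    using group.lagrange[OF subgroup_imp_group, of ?N A] subgroup_incl[OF assms(2)] 
      subgroup_subset_conj_stab[OF assms(2)] by (metis dvd_triv_right order_def partial_object.simps(1) partial_object.surjective partial_object.update_convs(1))
  then show ?thesis
    using conj_orbit_stabilizer[OF subgroup_self assms(1) subgroup.subset[OF assms(2)]]
    by (metis dvd_refl mult_dvd_mono order_def)
qed

lemma conj_stab_self_normal:
  assumes "subgroup B G" "\<And>h. h \<in> carrier G \<Longrightarrow> conj_set h B = B"
  shows "B \<lhd> G"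
  unfolding normal_inv_iff using assms by (auto simp: conj_set_def)

text \<open>In the quotient of the normalizer of \<open>Q\<close> by \<open>Q\<close>, the image of an element of \<open>P\<close> has
  order dividing both a power of \<open>p\<close> and a number prime to \<open>p\<close>.\<close>

lemma sylow_normalizing_eq:
  assumes fin: "finite (carrier G)" and p: "prime (p::nat)" and "\<not> p ^ Suc e dvd order G"
    and P: "subgroup P G" "card P = p ^ e" and Q: "subgroup Q G" "card Q = p ^ e"
    and norm: "\<And>x. x \<in> P \<Longrightarrow> conj_set x Q = Q"
  shows "P = Q"
proof -
  let ?N = "conj_stab (carrier G) Q"
  define L where "L = G\<lparr>carrier := ?N\<rparr>"
  have sN: "subgroup ?N G" using conj_stab_subgroup[OF subgroup_self] Q subgroup.subset by auto
  interpret L: group L unfolding L_def by (rule subgroup_imp_group[OF sN])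
  have QL: "subgroup Q L" unfolding L_def
    using subgroup_incl[OF Q(1) sN subgroup_subset_conj_stab[OF Q(1)]] .
  have QnL: "Q \<lhd> L"
    unfolding L.normal_inv_iff
  proof (intro conjI ballI QL)
    fix x h assume x: "x \<in> carrier L" and h: "h \<in> Q"
    then have "inv\<^bsub>L\<^esub> x = inv x" "conj_set x Q = Q"
      using m_inv_consistent[OF sN] by (auto simp: L_def conj_stab_def)
    moreover have "x \<otimes> h \<otimes> inv x \<in> conj_set x Q" using h by (auto simp: conj_set_def)
    ultimately show "x \<otimes>\<^bsub>L\<^esub> h \<otimes>\<^bsub>L\<^esub> inv\<^bsub>L\<^esub> x \<in> Q" by (simp add: L_def)
  qed
  interpret Q: normal Q L by fact
  interpret F: group "L Mod Q" by (rule Q.factorgroup_is_group)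
  have ordL: "order (L Mod Q) * p ^ e = card ?N"
    using L.lagrange[OF QL] Q by (simp add: FactGroup_def order_def L_def)
  have "card ?N dvd order G"
    using lagrange[OF sN] by (metis dvd_triv_right)
  then have "\<not> p dvd order (L Mod Q)"
    using assms(3) ordL by (metis dvd_trans mult_dvd_mono dvd_refl power_Suc)
  then have cop: "coprime (order (L Mod Q)) (p ^ e)"
    using p by (metis coprime_commute coprime_power_left_iff prime_imp_coprime)
  have "P \<subseteq> Q"
  proof
    fix x assume x: "x \<in> P"
    then have xL: "x \<in> carrier L" using P norm subgroup.mem_carrier by (auto simp: L_def conj_stab_def)
    let ?c = "Q #>\<^bsub>L\<^esub> x"
    have cF: "?c \<in> carrier (L Mod Q)" using xL by (auto simp: carrier_FactGroup)
    have finF: "finite (carrier (L Mod Q))"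
      using finite_subset[OF subgroup.subset[OF sN] fin] by (simp add: carrier_FactGroup L_def)
    interpret PG: group "G\<lparr>carrier := P\<rparr>" by (rule subgroup_imp_group[OF P(1)])
    have "x [^]\<^bsub>G\<lparr>carrier := P\<rparr>\<^esub> p ^ e = \<one>"
      using PG.pow_order_eq_1[of x] x P by (simp add: order_def)
    then have "x [^] (p ^ e) = \<one>" by (metis nat_pow_consistent)
    then have "x [^]\<^bsub>L\<^esub> (p ^ e) = \<one>\<^bsub>L\<^esub>" unfolding L_def by (simp add: nat_pow_consistent[symmetric])
    then have "?c [^]\<^bsub>L Mod Q\<^esub> (p ^ e) = \<one>\<^bsub>L Mod Q\<^esub>"
      using Q.FactGroup_pow[OF xL] QL L.coset_mult_one subgroup.subset by fastforce
    moreover have "?c [^]\<^bsub>L Mod Q\<^esub> (order (L Mod Q)) = \<one>\<^bsub>L Mod Q\<^esub>"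
      using F.pow_order_eq_1[OF cF] .
    ultimately have "F.ord ?c dvd p ^ e" "F.ord ?c dvd order (L Mod Q)"
      using F.pow_eq_id[OF cF] by auto
    then have "F.ord ?c = 1" using cop by (metis coprime_common_divisor_nat)
    then have "?c = Q" using F.ord_eq_1[OF cF] by simp
    then show "x \<in> Q" using L.rcos_self[OF xL QL] by simp
  qed
  then show ?thesis
    using P Q fin by (metis card_subset_eq finite_subset subgroup.subset)
qed

text \<open>Let \<open>P\<close> act on its own conjugates. A conjugate that \<open>P\<close>
  normalizes equals \<open>P\<close> by \<open>sylow_normalizing_eq\<close>, so there is exactly one
  fixed point.\<close>

lemma sylow_orbit_cong_1:
  assumes fin: "finite (carrier G)" and p: "prime (p::nat)" and "\<not> p ^ Suc e dvd order G"
    and P: "subgroup P G" "card P = p ^ e"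
  shows "[card (conj_orbit (carrier G) P) = 1] (mod p)"
proof -
  let ?O = "conj_orbit (carrier G) P"
  have Pc: "P \<subseteq> carrier G" using P subgroup.subset by auto
  have "[card ?O = card {B \<in> ?O. \<forall>g\<in>P. conj_set g B = B}] (mod p)"
  proof (rule card_fixed_points_cong[OF P(1) _ P(2) p])
    show "finite P" using Pc fin finite_subset by auto
    show "finite ?O" using fin by (simp add: conj_orbit_def)
    show "?O \<subseteq> Pow (carrier G)" using conj_orbit_subset Pc by blast
    show "conj_set g B \<in> ?O" if "g \<in> P" "B \<in> ?O" for g B
      using that conj_orbit_closed[OF subgroup_self Pc] Pc by blast
  qed
  moreover have "{B \<in> ?O. \<forall>g\<in>P. conj_set g B = B} = {P}"
  proof -
    have "B = P" if "B \<in> ?O" "\<forall>g\<in>P. conj_set g B = B" for B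
    proof -
      from that(1) obtain g where "g \<in> carrier G" "B = conj_set g P" by (auto simp: conj_orbit_def)
      then have "subgroup B G" "card B = p ^ e"
        using conj_set_subgroup P card_conj_set Pc by auto
      then show ?thesis using sylow_normalizing_eq[OF fin p assms(3) P] that by blast
    qed
    then show ?thesis
      using conj_orbit_self[OF subgroup_self Pc] subgroup_subset_conj_stab[OF P(1)]
      by (auto simp: conj_stab_def)
  qed
  ultimately show ?thesis by simp
qed

lemma sylow_subgroup_exists:
  assumes "finite (carrier G)" "prime (p::nat)" "p ^ a dvd order G"
  shows "\<exists>H. subgroup H G \<and> card H = p ^ a"
proof -
  from assms(3) obtain m where m: "order G = p ^ a * m" by (auto simp: dvd_def)
  show ?thesis by (rule sylow_thm[OF assms(2) is_group m assms(1)])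
qed

end

section \<open>Conjugation in finite non-abelian simple groups\<close>

locale nonabelian_simple_group = simple_group +
  assumes fin: "finite (carrier G)" and noncomm: "\<not> comm_group G"
begin

abbreviation conjugates :: "'a set \<Rightarrow> 'a set set" where
  "conjugates B \<equiv> conj_orbit (carrier G) B"

lemma finite_conjugates: "finite (conjugates B)"
  using fin by (simp add: conj_orbit_def)

lemma card_conjugates_pos: "card (conjugates B) > 0"
  using finite_conjugates by (auto simp: card_gt_0_iff conj_orbit_def)

lemma conjugates_nontrivial:
  assumes "subgroup B G" "B \<noteq> {\<one>}" "B \<noteq> carrier G"
  shows "card (conjugates B) \<noteq> 1"
proof
  assume "card (conjugates B) = 1"
  then have "\<forall>h\<in>carrier G. conj_set h B = B"
    using conj_orbit_trivial_iff[OF subgroup_self subgroup.subset[OF assms(1)]] by simp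
  then have "B \<lhd> G" using conj_stab_self_normal[OF assms(1)] by simp
  then show False using no_real_normal_subgroup assms by blast
qed

text \<open>The centre is normal, and it is not the whole group because the group is not
  commutative.\<close>

lemma central_imp_one:
  assumes "x \<in> carrier G" "\<And>y. y \<in> carrier G \<Longrightarrow> x \<otimes> y = y \<otimes> x"
  shows "x = \<one>"
proof -
  let ?Z = "{z \<in> carrier G. \<forall>y\<in>carrier G. z \<otimes> y = y \<otimes> z}"
  have "subgroup ?Z G"
  proof (rule subgroupI)
    show "inv a \<in> ?Z" if "a \<in> ?Z" for a
    proof -
      have "inv a \<otimes> y = y \<otimes> inv a" if y: "y \<in> carrier G" for y
      proof -
        have "a \<otimes> inv y = inv y \<otimes> a" and a: "a \<in> carrier G" using \<open>a \<in> ?Z\<close> y by auto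
        then have "inv (a \<otimes> inv y) = inv (inv y \<otimes> a)" by simp
        then show ?thesis using a y by (simp add: inv_mult_group)
      qed
      then show ?thesis using that by auto
    qed
    show "a \<otimes> b \<in> ?Z" if "a \<in> ?Z" "b \<in> ?Z" for a b
    proof -
      have ab: "a \<in> carrier G" "b \<in> carrier G" using that by auto
      have "a \<otimes> b \<otimes> y = y \<otimes> (a \<otimes> b)" if y: "y \<in> carrier G" for y
      proof -
        have c: "a \<otimes> y = y \<otimes> a" "b \<otimes> y = y \<otimes> b" using y \<open>a \<in> ?Z\<close> \<open>b \<in> ?Z\<close> by auto
        have "a \<otimes> b \<otimes> y = a \<otimes> (y \<otimes> b)" using ab y by (simp only: m_assoc c(2))
        also have "\<dots> = a \<otimes> y \<otimes> b" using ab y by (simp add: m_assoc)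
        also have "\<dots> = y \<otimes> a \<otimes> b" by (simp only: c)
        finally show ?thesis using ab y by (simp only: m_assoc)
      qed
      then show ?thesis using ab by simp
    qed
    show "?Z \<noteq> {}" by (auto intro!: exI[of _ \<one>])
  qed blast
  moreover have "a \<otimes> h \<otimes> inv a \<in> ?Z" if "a \<in> carrier G" "h \<in> ?Z" for a h
  proof -
    have h: "a \<otimes> h = h \<otimes> a" "h \<in> carrier G" using that by auto
    have "a \<otimes> h \<otimes> inv a = h \<otimes> (a \<otimes> inv a)"
      unfolding h(1) using h(2) \<open>a \<in> carrier G\<close> by (simp only: m_assoc inv_closed)
    then have "a \<otimes> h \<otimes> inv a = h" using h(2) \<open>a \<in> carrier G\<close> by simp
    then show ?thesis using that by simp
  qed
  ultimately have "?Z \<lhd> G" by (simp add: normal_inv_iff)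
  then have "?Z = carrier G \<or> ?Z = {\<one>}" by (rule no_real_normal_subgroup)
  moreover have "?Z \<noteq> carrier G"
  proof
    assume "?Z = carrier G"
    then have "\<And>x y. \<lbrakk>x \<in> carrier G; y \<in> carrier G\<rbrakk> \<Longrightarrow> x \<otimes> y = y \<otimes> x" by blast
    then show False using noncomm group_comm_groupI by blast
  qed
  ultimately show ?thesis using assms by blast
qed

lemma conj_set_singleton_iff:
  assumes "g \<in> carrier G" "x \<in> carrier G"
  shows "conj_set g {x} = {x} \<longleftrightarrow> g \<otimes> x = x \<otimes> g"
proof -
  have "g \<otimes> x \<otimes> inv g = x \<longleftrightarrow> g \<otimes> x = x \<otimes> g"
    using assms inv_solve_right' by auto
  then show ?thesis by (simp add: conj_set_def)
qed

lemma conjugates_singleton_nontrivial: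
  assumes "x \<in> carrier G" "x \<noteq> \<one>"
  shows "card (conjugates {x}) \<noteq> 1"
proof
  assume "card (conjugates {x}) = 1"
  then have "\<forall>g\<in>carrier G. g \<otimes> x = x \<otimes> g"
    using assms conj_orbit_trivial_iff[OF subgroup_self] conj_set_singleton_iff by auto
  then show False using assms central_imp_one[of x] by auto
qed

text \<open>The kernel of the action on the orbit is normal; it is a proper subgroup because the
  orbit has more than one member.\<close>

lemma conjugation_faithful:
  assumes B: "B \<subseteq> carrier G" and "card (conjugates B) \<noteq> 1"
    and g: "g \<in> carrier G" "\<And>C. C \<in> conjugates B \<Longrightarrow> conj_set g C = C"
  shows "g = \<one>"
proof -
  let ?K = "{g \<in> carrier G. \<forall>C \<in> conjugates B. conj_set g C = C}"
  have Oc: "C \<subseteq> carrier G" if "C \<in> conjugates B" for C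
    using that B conj_orbit_subset by blast
  have "subgroup ?K G"
  proof (rule subgroupI)
    have "\<one> \<in> ?K" using conj_set_one Oc by simp
    then show "?K \<noteq> {}" by blast
    show "inv a \<in> ?K" if a: "a \<in> ?K" for a
    proof -
      have "conj_set (inv a) C = C" if "C \<in> conjugates B" for C
        using conj_set_inv(1)[of a C] a Oc[OF that] that by simp
      then show ?thesis using a by simp
    qed
    show "a \<otimes> b \<in> ?K" if ab: "a \<in> ?K" "b \<in> ?K" for a b
    proof -
      have "conj_set (a \<otimes> b) C = C" if "C \<in> conjugates B" for C
        using conj_set_mult[of a b C] ab Oc[OF that] that by simp
      then show ?thesis using ab by simp
    qed
  qed auto
  moreover have "a \<otimes> h \<otimes> inv a \<in> ?K" if "a \<in> carrier G" "h \<in> ?K" for a h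
  proof -
    have "conj_set (a \<otimes> h \<otimes> inv a) C = C" if C: "C \<in> conjugates B" for C
    proof -
      have "conj_set (inv a) C \<in> conjugates B"
        using C \<open>a \<in> carrier G\<close> conj_orbit_closed[OF subgroup_self B] by simp
      then have "conj_set h (conj_set (inv a) C) = conj_set (inv a) C" using \<open>h \<in> ?K\<close> by auto
      then have "conj_set a (conj_set h (conj_set (inv a) C)) = C"
        using C Oc \<open>a \<in> carrier G\<close> by (simp add: conj_set_inv)
      then show ?thesis
        using C Oc \<open>a \<in> carrier G\<close> \<open>h \<in> ?K\<close> conj_set_closed by (simp add: conj_set_mult m_assoc)
    qed
    then show ?thesis using that by auto
  qed
  ultimately have "?K \<lhd> G" by (simp add: normal_inv_iff)
  then have "?K = carrier G \<or> ?K = {\<one>}" by (rule no_real_normal_subgroup)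
  moreover have "?K \<noteq> carrier G"
  proof
    assume "?K = carrier G"
    then have "\<forall>g\<in>carrier G. conj_set g B = B"
      using conj_orbit_self[OF subgroup_self B] by blast
    then show False using assms(2) conj_orbit_trivial_iff[OF subgroup_self B] by blast
  qed
  ultimately show ?thesis using g by blast
qed

text \<open>The conjugation action embeds \<open>G\<close> into a symmetric group; by simplicity the sign
  character is trivial on the image.\<close>

lemma order_dvd_fact_conjugates:
  assumes B: "B \<subseteq> carrier G" and ne1: "card (conjugates B) \<noteq> 1"
  shows "2 * order G dvd fact (card (conjugates B))"
proof -
  let ?O = "conjugates B"
  define m where "m = card ?O"
  let ?I = "{1..m}"
  have m2: "m \<ge> 2" using ne1 card_conjugates_pos[of B] unfolding m_def by linarith
  obtain h where h: "bij_betw h ?I ?O"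
    using ex_bij_betw_nat_finite_1[OF finite_conjugates] unfolding m_def by blast
  define k where "k = inv_into ?I h"
  have k: "bij_betw k ?O ?I" unfolding k_def using bij_betw_inv_into[OF h] .
  have hk: "h (k C) = C" if "C \<in> ?O" for C
    unfolding k_def using bij_betw_inv_into_right[OF h that] .
  have kh: "k (h i) = i" if "i \<in> ?I" for i
    unfolding k_def using bij_betw_inv_into_left[OF h that] .
  have hO: "h i \<in> ?O" if "i \<in> ?I" for i using h that bij_betwE by blast
  have kI: "k C \<in> ?I" if "C \<in> ?O" for C using k that bij_betwE by blast
  have Oc: "C \<subseteq> carrier G" if "C \<in> ?O" for C
    using that B conj_orbit_subset by blast
  have cO: "conj_set g C \<in> ?O" if "g \<in> carrier G" "C \<in> ?O" for g C
    using that conj_orbit_closed[OF subgroup_self B] by blast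
  \<comment> \<open>The members of the orbit are numbered from 1 to \<open>m\<close> by
    \<open>k\<close>. Outside this range the value must be \<open>i\<close> itself, since a
    permutation of \<open>?I\<close> fixes every point outside it.\<close>
  define \<phi> where "\<phi> = (\<lambda>g i. if i \<in> ?I then k (conj_set g (h i)) else i)"
  have perm: "\<phi> g permutes ?I" if g: "g \<in> carrier G" for g
  proof (rule bij_imp_permutes)
    have "inj_on (\<phi> g) ?I"
    proof (rule inj_onI)
      fix i j assume ij: "i \<in> ?I" "j \<in> ?I" "\<phi> g i = \<phi> g j"
      then have "conj_set g (h i) = conj_set g (h j)"
        using hk cO[OF g] hO unfolding \<phi>_def by (metis (no_types, lifting))
      then have "h i = h j" using conj_set_inv(1)[OF g] Oc hO ij by metis
      then show "i = j" using kh ij by metis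
    qed
    moreover have "\<phi> g ` ?I \<subseteq> ?I" using kI cO[OF g] hO by (auto simp: \<phi>_def simp del: atLeastAtMost_iff)
    ultimately show "bij_betw (\<phi> g) ?I ?I"
      by (simp add: bij_betw_def endo_inj_surj)
  qed (auto simp: \<phi>_def)
  have hom: "\<phi> \<in> hom G (sym_group m)"
  proof (rule homI)
    show "\<phi> g \<in> carrier (sym_group m)" if "g \<in> carrier G" for g
      using perm[OF that] by (simp add: sym_group_carrier)
    show "\<phi> (x \<otimes> y) = \<phi> x \<otimes>\<^bsub>sym_group m\<^esub> \<phi> y" if xy: "x \<in> carrier G" "y \<in> carrier G" for x y
    proof
      fix i
      show "\<phi> (x \<otimes> y) i = (\<phi> x \<otimes>\<^bsub>sym_group m\<^esub> \<phi> y) i"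
      proof (cases "i \<in> ?I")
        case True
        then have "conj_set y (h i) \<in> ?O" using cO[OF xy(2)] hO by blast
        then show ?thesis
          using True kI hk conj_set_mult[OF xy Oc[OF hO[OF True]]]
          by (simp add: sym_group_mult \<phi>_def del: atLeastAtMost_iff)
      qed (auto simp: sym_group_mult \<phi>_def)
    qed
  qed
  interpret \<Phi>: group_hom G "sym_group m" \<phi>
    using hom sym_group_is_group by (simp add: group_hom_def group_hom_axioms_def is_group)
  have inj: "inj_on \<phi> (carrier G)"
    unfolding \<Phi>.inj_on_one_iff
  proof (intro allI impI)
    fix g assume g: "g \<in> carrier G" "\<phi> g = \<one>\<^bsub>sym_group m\<^esub>"
    show "g = \<one>"
    proof (rule conjugation_faithful[OF B ne1 g(1)])
      fix C assume C: "C \<in> ?O"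
      have "\<phi> g (k C) = k C" using g(2) by (simp add: sym_group_one)
      then have "k (conj_set g C) = k C" using kI[OF C] hk[OF C] by (simp add: \<phi>_def)
      then show "conj_set g C = C" using hk[OF C] hk[OF cO[OF g(1) C]] by metis
    qed
  qed
  interpret sgn: group_hom "sym_group m" sign_img sign by (rule sign_group_hom)
  have "sign \<circ> \<phi> \<in> hom G sign_img"
    by (rule homI) (simp_all add: \<Phi>.hom_mult sgn.hom_mult)
  then interpret S: group_hom G sign_img "sign \<circ> \<phi>"
    using sign_img_is_group by (simp add: group_hom_def group_hom_axioms_def is_group)
  have "kernel G sign_img (sign \<circ> \<phi>) = carrier G"
  proof (rule ccontr)
    assume "kernel G sign_img (sign \<circ> \<phi>) \<noteq> carrier G"
    then have "kernel G sign_img (sign \<circ> \<phi>) = {\<one>}"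
      using no_real_normal_subgroup[OF S.normal_kernel] by blast
    then have i: "inj_on (sign \<circ> \<phi>) (carrier G)" by (simp add: S.inj_iff_trivial_ker)
    have "x \<otimes> y = y \<otimes> x" if "x \<in> carrier G" "y \<in> carrier G" for x y
    proof (rule inj_onD[OF i])
      show "(sign \<circ> \<phi>) (x \<otimes> y) = (sign \<circ> \<phi>) (y \<otimes> x)"
        using S.hom_mult[OF that] S.hom_mult[OF that(2,1)] by (simp add: sign_img_def mult.commute)
    qed (use that in auto)
    then show False using noncomm group_comm_groupI by blast
  qed
  then have sub: "\<phi> ` carrier G \<subseteq> carrier (alt_group m)"
    unfolding alt_group_is_sign_kernel by (auto simp: kernel_def)
  have "subgroup (\<phi> ` carrier G) ((sym_group m)\<lparr>carrier := carrier (alt_group m)\<rparr>)"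
    using group.subgroup_incl[OF sym_group_is_group \<Phi>.img_is_subgroup alt_group_is_subgroup sub] .
  then have "subgroup (\<phi> ` carrier G) (alt_group m)" by (simp add: alt_group_def)
  then have "card (\<phi> ` carrier G) dvd order (alt_group m)"
    using group.lagrange[OF alt_group_is_group] by (metis dvd_triv_right)
  then have "order G dvd card (carrier (alt_group m))"
    using card_image[OF inj] by (simp add: order_def)
  then show ?thesis
    using alt_group_card_carrier[OF m2] unfolding m_def by (metis dvd_refl mult_dvd_mono)
qed

section \<open>Lower bounds for the order and for orbit sizes\<close>

text \<open>For \<open>x\<close> other than the identity, the class of \<open>x\<close> has more
  than one member and its centralizer contains both \<open>\<one>\<close> and \<open>x\<close>, so
  the order is a product of two factors greater than 1.\<close>

lemma order_not_prime: "\<not> prime (order G)"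
proof
  assume p: "prime (order G)"
  obtain x where x: "x \<in> carrier G" "x \<noteq> \<one>"
    using simple_not_triv one_closed by blast
  let ?S = "conj_stab (carrier G) {x}"
  have eq: "card (conjugates {x}) * card ?S = order G"
    using conj_orbit_stabilizer[OF subgroup_self fin] x by (simp add: order_def)
  then have "card ?S = 1"
    using p conjugates_singleton_nontrivial[OF x] by (metis prime_product)
  moreover have "{\<one>, x} \<subseteq> ?S"
    using x by (auto simp: conj_stab_def conj_set_singleton_iff)
  moreover have "finite ?S" using fin by (simp add: conj_stab_def)
  ultimately have "card {\<one>, x} \<le> 1" by (metis card_mono)
  then show False using x by simp
qed

text \<open>The orders 4, 6 and 12 have the form \<open>p ^ a * q\<close> with \<open>q\<close>
  equal to 2 or 3. A subgroup of order \<open>p ^ a\<close> then has exactly \<open>q\<close>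
  conjugates, and twice the group order would divide \<open>fact q\<close>, which is too small. The
  orders 2 and 3 are prime.\<close>

lemma order_not_dvd_12: "\<not> order G dvd 12"
proof
  assume d: "order G dvd 12"
  have red: False if q: "p ^ a * q = order G" "prime p" "p ^ a \<noteq> 1" "q \<in> {2, 3}" "q = 3 \<longrightarrow> order G > 3"
    for p a q :: nat
  proof -
    obtain P where P: "subgroup P G" "card P = p ^ a"
      using sylow_subgroup_exists[OF fin q(2), of a] q(1) by (metis dvd_triv_left)
    have "p ^ a \<noteq> order G" "p ^ a > 0" using q prime_gt_0_nat[of p] by auto
    then have "card P \<noteq> card {\<one>}" "card P \<noteq> card (carrier G)" using P q(3) by (simp_all add: order_def)
    then have "P \<noteq> {\<one>}" "P \<noteq> carrier G" by blast+
    then have m1: "card (conjugates P) \<noteq> 1" using conjugates_nontrivial P by blast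
    have "card (conjugates P) * p ^ a dvd q * p ^ a"
      using card_conj_orbit_mult_dvd[OF fin P(1)] q(1) P(2) by (simp add: mult.commute)
    then have "card (conjugates P) dvd q" using prime_gt_0_nat[OF q(2)] by simp
    moreover have "prime q" using q(4) by auto
    ultimately have "card (conjugates P) = q" using m1 by (metis prime_nat_iff)
    then have "2 * order G dvd fact q"
      using order_dvd_fact_conjugates[OF subgroup.subset[OF P(1)] m1] by simp
    then have "2 * order G \<le> fact q" by (simp add: dvd_imp_le)
    then show False using q order_gt_one by (auto simp: fact_numeral)
  qed
  have "n \<in> {2,3,4,6,12}" if n: "n dvd 12" "n > 1" for n :: nat
  proof -
    have "n \<le> 12" using dvd_imp_le[OF n(1)] by simp
    then have "n = 2 \<or> n = 3 \<or> n = 4 \<or> n = 5 \<or> n = 6 \<or> n = 7 \<or> n = 8 \<or> n = 9 \<or> n = 10 \<or> n = 11 \<or> n = 12"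
      using n(2) by presburger
    then show ?thesis using n(1) by (elim disjE) simp_all
  qed
  from this[OF d order_gt_one]
  consider "order G = 2" | "order G = 3" | "order G = 4" | "order G = 6" | "order G = 12"
    by blast
  then show False
  proof cases
    case 1 then show False using order_not_prime by simp
  next
    case 2 then show False using order_not_prime by simp
  next
    case 3 then show False using red[of 2 1 2] by simp
  next
    case 4 then show False using red[of 3 1 2] by simp
  next
    case 5 then show False using red[of 2 2 3] by simp
  qed
qed

text \<open>An orbit with two to four members would make the order a divisor of 12, which is half of
  \<open>fact 4\<close>.\<close>

lemma card_conjugates_ge_5:
  assumes "B \<subseteq> carrier G" "card (conjugates B) \<noteq> 1"
  shows "card (conjugates B) \<ge> 5"
proof (rule ccontr)
  assume "\<not> ?thesis"
  then have "card (conjugates B) \<le> 4" by simp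
  then have "(fact (card (conjugates B)) :: nat) dvd fact 4" by (rule fact_dvd)
  then have "2 * order G dvd fact 4"
    using order_dvd_fact_conjugates[OF assms] dvd_trans by blast
  also have "fact 4 = 2 * (12::nat)" by (simp add: fact_numeral)
  finally show False using order_not_dvd_12 by simp
qed

lemma card_conjugates_sylow_cong:
  assumes "prime (p::nat)" "subgroup P G" "card P = p ^ e" "\<not> p ^ Suc e dvd order G" "P \<noteq> {\<one>}" "P \<noteq> carrier G"
  shows "card (conjugates P) mod p = 1" "card (conjugates P) \<ge> 5"
proof -
  show "card (conjugates P) mod p = 1"
    using sylow_orbit_cong_1[OF fin assms(1,4,2,3)] prime_gt_1_nat[OF assms(1)] by (simp add: cong_def)
  show "card (conjugates P) \<ge> 5"
    using card_conjugates_ge_5 subgroup.subset[OF assms(2)] conjugates_nontrivial[OF assms(2,5,6)] by blast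
qed

lemma commuting_conj_set:
  assumes "g \<in> carrier G" "B \<subseteq> carrier G" "\<And>b. b \<in> B \<Longrightarrow> g \<otimes> b = b \<otimes> g"
  shows "conj_set g B = B"
proof -
  have "g \<otimes> b \<otimes> inv g = b" if "b \<in> B" for b
    using that assms by (simp add: m_assoc subset_iff)
  then show ?thesis by (simp add: conj_set_def)
qed

end

section \<open>Abelian covers of simple groups\<close>

text \<open>One representative is chosen per orbit. They are kept in a list so that a case
  distinction on its length names them; the cardinality equation records that the orbits are
  disjoint.\<close>

lemma (in group) conj_invariant_representatives:
  assumes "finite X" "X \<subseteq> Pow (carrier G)"
    and "\<And>g B. g \<in> carrier G \<Longrightarrow> B \<in> X \<Longrightarrow> conj_set g B \<in> X"
  shows "\<exists>Bs. set Bs \<subseteq> X \<and> X = (\<Union>B\<in>set Bs. conj_orbit (carrier G) B)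
           \<and> card X = (\<Sum>B\<leftarrow>Bs. card (conj_orbit (carrier G) B))"
  using assms
proof (induction X rule: finite_psubset_induct)
  case (psubset X)
  show ?case
  proof (cases "X = {}")
    case True then show ?thesis by (intro exI[of _ "[]"]) simp
  next
    case False
    then obtain B where B: "B \<in> X" by auto
    then have Bc: "B \<subseteq> carrier G" using psubset by auto
    let ?O = "conj_orbit (carrier G) B"
    have OX: "?O \<subseteq> X" using psubset(4) B by (auto simp: conj_orbit_def)
    have BO: "B \<in> ?O" using conj_orbit_self[OF subgroup_self Bc] .
    have "\<exists>Bs. set Bs \<subseteq> X - ?O \<and> X - ?O = (\<Union>B\<in>set Bs. conj_orbit (carrier G) B)
           \<and> card (X - ?O) = (\<Sum>B\<leftarrow>Bs. card (conj_orbit (carrier G) B))"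
    proof (rule psubset.IH)
      show "X - ?O \<subset> X" using BO B by blast
      show "X - ?O \<subseteq> Pow (carrier G)" using psubset.prems by auto
      show "conj_set g C \<in> X - ?O" if "g \<in> carrier G" "C \<in> X - ?O" for g C
        using that psubset.prems conj_orbit_disjoint[OF subgroup_self Bc] by blast
    qed
    then obtain Bs where Bs: "set Bs \<subseteq> X - ?O" "X - ?O = (\<Union>B\<in>set Bs. conj_orbit (carrier G) B)"
      "card (X - ?O) = (\<Sum>B\<leftarrow>Bs. card (conj_orbit (carrier G) B))" by blast
    have "card X = card ?O + card (X - ?O)"
      using OX psubset(1) by (metis card_Diff_subset card_mono finite_subset le_add_diff_inverse)
    moreover have "X = (\<Union>C\<in>set (B # Bs). conj_orbit (carrier G) C)" using Bs(2) OX by auto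
    ultimately show ?thesis using Bs B by (intro exI[of _ "B # Bs"]) auto
  qed
qed

text \<open>These are the properties that the centres of centralizers hand on to sections. The
  trivial subgroup is barred because its orbit has size 1, which would spoil the bound 5 on orbit
  sizes; accordingly the identity need not be covered.\<close>

locale abelian_cover = nonabelian_simple_group +
  fixes \<A> :: "'a set set"
  assumes cover_subgroup: "A \<in> \<A> \<Longrightarrow> subgroup A G"
    and cover_comm: "\<lbrakk>A \<in> \<A>; x \<in> A; y \<in> A\<rbrakk> \<Longrightarrow> x \<otimes> y = y \<otimes> x"
    and cover_nontrivial: "A \<in> \<A> \<Longrightarrow> A \<noteq> {\<one>}"
    and cover_conj: "\<lbrakk>A \<in> \<A>; g \<in> carrier G\<rbrakk> \<Longrightarrow> conj_set g A \<in> \<A>"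
    and cover: "\<lbrakk>x \<in> carrier G; x \<noteq> \<one>\<rbrakk> \<Longrightarrow> \<exists>A\<in>\<A>. x \<in> A"
begin

lemma cover_subset: "A \<in> \<A> \<Longrightarrow> A \<subseteq> carrier G"
  using cover_subgroup subgroup.subset by auto

lemma finite_cover: "finite \<A>"
  using fin cover_subset finite_subset[of \<A> "Pow (carrier G)"] by auto

lemma finite_cover_member: "A \<in> \<A> \<Longrightarrow> finite A"
  using cover_subset fin finite_subset by blast

lemma cover_proper: "A \<in> \<A> \<Longrightarrow> A \<noteq> carrier G"
  using cover_comm noncomm group_comm_groupI by blast

lemma cover_orbit_nontrivial: "A \<in> \<A> \<Longrightarrow> card (conjugates A) \<noteq> 1"
  using conjugates_nontrivial cover_subgroup cover_nontrivial cover_proper by blast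

lemma cover_orbit_ge_5: "A \<in> \<A> \<Longrightarrow> card (conjugates A) \<ge> 5"
  using card_conjugates_ge_5 cover_subset cover_orbit_nontrivial by blast

lemma cover_card_ge_2:
  assumes "A \<in> \<A>" shows "card A \<ge> 2"
proof -
  have "\<one> \<in> A" using assms cover_subgroup subgroup.one_closed by auto
  then obtain x where "x \<in> A" "x \<noteq> \<one>" using cover_nontrivial[OF assms] by blast
  then have "{\<one>, x} \<subseteq> A" "card {\<one>, x} = 2" using \<open>\<one> \<in> A\<close> by auto
  then show ?thesis using card_mono finite_cover_member[OF assms] by metis
qed

lemma cover_card_dvd:
  "A \<in> \<A> \<Longrightarrow> card (conjugates A) * card A dvd order G"
  using card_conj_orbit_mult_dvd[OF fin] cover_subgroup by blast

section \<open>Sylow subgroups inside the members of a cover\<close>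

text \<open>A member that contains one nontrivial element of a subgroup of prime order contains the
  whole subgroup, because their intersection has order dividing that prime.\<close>

lemma prime_subgroup_in_cover:
  assumes "prime (p::nat)" "p dvd order G" "set As \<subseteq> \<A>" "\<A> = (\<Union>B\<in>set As. conjugates B)"
  shows "\<exists>A\<in>set As. \<exists>T. subgroup T G \<and> card T = p \<and> T \<subseteq> A"
proof -
  obtain P where P: "subgroup P G" "card P = p"
    using sylow_subgroup_exists[OF fin assms(1), of 1] assms(2) by auto
  have Pc: "P \<subseteq> carrier G" using P subgroup.subset by auto
  then have finP: "finite P" using fin finite_subset by auto
  have "\<one> \<in> P" using P subgroup.one_closed by auto
  have "P \<noteq> {\<one>}" using P(2) prime_gt_1_nat[OF assms(1)] by auto
  then obtain x where x: "x \<in> P" "x \<noteq> \<one>" using \<open>\<one> \<in> P\<close> by blast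
  then obtain A' where A': "A' \<in> \<A>" "x \<in> A'" using cover Pc by blast
  have sI: "subgroup (A' \<inter> P) G" using subgroups_Inter_pair cover_subgroup[OF A'(1)] P(1) by auto
  then have "subgroup (A' \<inter> P) (G\<lparr>carrier := P\<rparr>)" using subgroup_incl P(1) by auto
  then have "card (A' \<inter> P) dvd card P"
    using group.lagrange[OF subgroup_imp_group[OF P(1)], of "A' \<inter> P"]
    by (auto simp: order_def dest: sym)
  moreover have "card (A' \<inter> P) \<noteq> 1"
  proof
    assume "card (A' \<inter> P) = 1"
    moreover have "\<one> \<in> A' \<inter> P" "x \<in> A' \<inter> P" using sI subgroup.one_closed x A' by blast+
    ultimately show False using x(2) by (metis card_1_singletonE singletonD)
  qed
  ultimately have "card (A' \<inter> P) = card P" using P(2) assms(1) by (metis prime_nat_iff)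
  then have "P \<subseteq> A'" using finP by (metis card_subset_eq inf_le2 inf.absorb_iff2 inf_commute)
  \<comment> \<open>The member found is conjugate to a chosen representative; the same conjugation
    carries \<open>P\<close> into that representative.\<close>
  obtain A where A: "A \<in> set As" "A' \<in> conjugates A" using A' assms(4) by blast
  then obtain g where g: "g \<in> carrier G" "A = conj_set g A'"
    using conj_orbit_sym[OF subgroup_self, of A A'] cover_subset assms(3) by (auto simp: conj_orbit_def)
  show ?thesis
    using A(1) conj_set_subgroup[OF g(1) P(1)] card_conj_set[OF g(1) Pc] P(2) 
      conj_set_mono[OF \<open>P \<subseteq> A'\<close>] g(2) by blast
qed

text \<open>If \<open>g\<close> normalizes \<open>A\<close>, then the conjugate of \<open>T\<close>
  by \<open>g\<close> lies in the abelian group \<open>A\<close>, so \<open>T\<close> centralizes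
  it, and two Sylow subgroups one of which normalizes the other coincide. Hence the normalizer of
  \<open>A\<close> lies in that of \<open>T\<close>.\<close>

lemma sylow_in_cover:
  assumes p: "prime (p::nat)" "\<not> p ^ 2 dvd order G" and A: "A \<in> \<A>" 
    and T: "subgroup T G" "card T = p" "T \<subseteq> A"
  shows "card (conjugates T) dvd card (conjugates A)"
    and "card (conjugates T) mod p = 1" and "card (conjugates T) \<ge> 5"
proof -
  have p2: "\<not> p ^ Suc 1 dvd order G" using p(2) by (simp add: power2_eq_square)
  have Tc: "T \<subseteq> carrier G" using T subgroup.subset by auto
  have Ac: "A \<subseteq> carrier G" using A cover_subset by auto
  have T1: "T \<noteq> {\<one>}" using T(2) prime_gt_1_nat[OF p(1)] by auto
  have TG: "T \<noteq> carrier G" using T(3) Ac cover_proper[OF A] by auto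
  show "card (conjugates T) mod p = 1" "card (conjugates T) \<ge> 5"
    using card_conjugates_sylow_cong[OF p(1) T(1) _ p2 T1 TG] T(2) by auto
  have "conj_set g T = T" if g: "g \<in> carrier G" "conj_set g A = A" for g
  proof -
    have gT: "subgroup (conj_set g T) G" "card (conj_set g T) = p ^ 1"
      using conj_set_subgroup[OF g(1) T(1)] card_conj_set[OF g(1) Tc] T(2) by auto
    have "conj_set g T \<subseteq> A" using conj_set_mono[OF T(3), of g] g by simp
    then have "conj_set x (conj_set g T) = conj_set g T" if "x \<in> T" for x
      using commuting_conj_set[of x "conj_set g T"] that T(3) Ac cover_comm[OF A] by blast
    then show ?thesis
      using sylow_normalizing_eq[OF fin p(1) p2 T(1) _ gT] T(2) by simp
  qed
  then have "conj_stab (carrier G) A \<subseteq> conj_stab (carrier G) T" by (auto simp: conj_stab_def)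
  then show "card (conjugates T) dvd card (conjugates A)"
    using card_conj_orbit_dvd[OF fin Ac Tc] by simp
qed

text \<open>The number \<open>d\<close> is the number of Sylow \<open>p\<close>-subgroups. This
  turns a prime divisor of the order into a condition on the orbit sizes of the cover.\<close>

lemma cover_prime_divisor:
  assumes "prime (p::nat)" "p dvd order G" "\<not> p ^ 2 dvd order G"
    and "set As \<subseteq> \<A>" "\<A> = (\<Union>B\<in>set As. conjugates B)"
  shows "\<exists>A\<in>set As. \<exists>d. d dvd card (conjugates A) \<and> d mod p = 1 \<and> d \<ge> 5"
  using prime_subgroup_in_cover[OF assms(1,2,4,5)] sylow_in_cover[OF assms(1,3)] assms(4)
  by (metis subsetD)

lemma order_le_sum:
  assumes "set As \<subseteq> \<A>" "\<A> = (\<Union>B\<in>set As. conjugates B)"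
  shows "order G \<le> 1 + (\<Sum>A\<leftarrow>As. card (conjugates A) * (card A - 1))"
proof -
  let ?U = "\<lambda>A. \<Union>C\<in>conjugates A. C - {\<one>}"
  have cU: "card (?U A) \<le> card (conjugates A) * (card A - 1)" if "A \<in> set As" for A
  proof -
    have A: "A \<in> \<A>" using that assms(1) by auto
    have "card (C - {\<one>}) = card A - 1" if C: "C \<in> conjugates A" for C
    proof -
      have "C \<in> \<A>" using C A cover_conj by (auto simp: conj_orbit_def)
      then have "\<one> \<in> C" using cover_subgroup subgroup.one_closed by auto
      then show ?thesis
        using C card_conj_set[OF _ cover_subset[OF A]] by (auto simp: conj_orbit_def)
    qed
    then show ?thesis
      using card_UN_le[OF finite_conjugates[of A], of "\<lambda>C. C - {\<one>}"] by simp
  qed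
  have "carrier G \<subseteq> {\<one>} \<union> (\<Union>A\<in>set As. ?U A)" using cover assms(2) by blast
  moreover have "finite (?U A)" if "A \<in> set As" for A
  proof -
    have "C \<in> \<A>" if "C \<in> conjugates A" for C
      using that \<open>A \<in> set As\<close> assms(1) cover_conj by (auto simp: conj_orbit_def)
    then show ?thesis using finite_conjugates finite_cover_member by auto
  qed
  ultimately have "order G \<le> card ({\<one>} \<union> (\<Union>A\<in>set As. ?U A))"
    unfolding order_def by (intro card_mono) auto
  also have "\<dots> \<le> 1 + card (\<Union>A\<in>set As. ?U A)" by (metis card_Un_le is_singletonI is_singleton_altdef)
  also have "card (\<Union>A\<in>set As. ?U A) \<le> (\<Sum>A\<in>set As. card (?U A))"
    by (intro card_UN_le) simp
  also have "\<dots> \<le> (\<Sum>A\<in>set As. card (conjugates A) * (card A - 1))"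
    using cU by (intro sum_mono)
  \<comment> \<open>A repeated entry of the list can only increase the sum.\<close>
  also have "\<dots> \<le> (\<Sum>A\<leftarrow>As. card (conjugates A) * (card A - 1))"
    by (induction As) (auto simp: insert_absorb sum.insert_if)
  finally show ?thesis by simp
qed

end

section \<open>Abelian Frobenius complements of small index\<close>

lemma (in group) card_subgroup_dvd:
  assumes "subgroup H G" "subgroup K G" "H \<subseteq> K"
  shows "card H dvd card K"
proof -
  have "subgroup H (G\<lparr>carrier := K\<rparr>)" using subgroup_incl assms by auto
  then have "card (rcosets\<^bsub>G\<lparr>carrier := K\<rparr>\<^esub> H) * card H = card K"
    using group.lagrange[OF subgroup_imp_group[OF assms(2)]] by (simp add: order_def)
  then show ?thesis by (metis dvd_triv_right)
qed

lemma (in group) sylow_subgroup_exists_in: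
  assumes "finite (carrier G)" "subgroup A G" "prime (p::nat)" "p ^ e dvd card A"
  shows "\<exists>T. subgroup T G \<and> card T = p ^ e \<and> T \<subseteq> A"
proof -
  interpret A: group "G\<lparr>carrier := A\<rparr>" by (rule subgroup_imp_group[OF assms(2)])
  have "finite A" using assms(1,2) finite_subset subgroup.subset by blast
  then obtain T where T: "subgroup T (G\<lparr>carrier := A\<rparr>)" "card T = p ^ e"
    using A.sylow_subgroup_exists[of p e] assms(3,4) by (auto simp: order_def)
  then show ?thesis using incl_subgroup[OF assms(2)] subgroup.subset[OF T(1)] by auto
qed

lemma (in group) coprime_subgroups_trivial_Int:
  assumes "subgroup H G" "subgroup K G" "coprime (card H) (card K)"
  shows "H \<inter> K = {\<one>}"
proof -
  have s: "subgroup (H \<inter> K) G" using subgroups_Inter_pair assms by auto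
  then have "card (H \<inter> K) dvd card H" "card (H \<inter> K) dvd card K"
    using card_subgroup_dvd assms by auto
  then have "card (H \<inter> K) = 1" using assms(3) by (metis coprime_common_divisor_nat)
  then show ?thesis using subgroup.one_closed[OF s] by (metis card_1_singletonE singletonD)
qed

context nonabelian_simple_group
begin

text \<open>Trivial intersections make the sets \<open>C - {\<one>}\<close> disjoint, so the union
  bound becomes an equality.\<close>

lemma card_union_conjugates:
  assumes "subgroup B G" and TI: "\<And>C D. \<lbrakk>C \<in> conjugates B; D \<in> conjugates B; C \<noteq> D\<rbrakk> \<Longrightarrow> C \<inter> D = {\<one>}"
  shows "card (\<Union>C\<in>conjugates B. C - {\<one>}) = card (conjugates B) * (card B - 1)"
proof -
  have Bc: "B \<subseteq> carrier G" using assms(1) subgroup.subset by auto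
  have "card (\<Union>C\<in>conjugates B. C - {\<one>}) = (\<Sum>C\<in>conjugates B. card (C - {\<one>}))"
  proof (rule card_UN_disjoint[OF finite_conjugates])
    show "\<forall>C\<in>conjugates B. finite (C - {\<one>})"
      using conj_orbit_subset[OF order.refl Bc] fin finite_subset by blast
    show "\<forall>C\<in>conjugates B. \<forall>D\<in>conjugates B. C \<noteq> D \<longrightarrow> (C - {\<one>}) \<inter> (D - {\<one>}) = {}"
      using TI by blast
  qed
  also have "card (C - {\<one>}) = card B - 1" if "C \<in> conjugates B" for C
  proof -
    obtain g where g: "g \<in> carrier G" "C = conj_set g B" using \<open>C \<in> _\<close> by (auto simp: conj_orbit_def)
    then have "\<one> \<in> C" using conj_set_subgroup assms(1) subgroup.one_closed by blast
    then show ?thesis using card_conj_set[OF g(1) Bc] g(2) by simp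
  qed
  then have "(\<Sum>C\<in>conjugates B. card (C - {\<one>})) = card (conjugates B) * (card B - 1)" by simp
  finally show ?thesis .
qed

lemma prime_order_conjugates_TI:
  assumes "subgroup P G" "prime (card P)" "C \<in> conjugates P" "D \<in> conjugates P" "C \<noteq> D"
  shows "C \<inter> D = {\<one>}"
proof -
  have Pc: "P \<subseteq> carrier G" using assms(1) subgroup.subset by auto
  have sub: "subgroup X G" "card X = card P" if "X \<in> conjugates P" for X
    using that conj_set_subgroup assms(1) card_conj_set Pc by (auto simp: conj_orbit_def)
  have finX: "finite X" if "X \<in> conjugates P" for X
    using sub(1)[OF that] subgroup.subset fin finite_subset by blast
  have s: "subgroup (C \<inter> D) G" using subgroups_Inter_pair sub(1) assms(3,4) by auto
  have "card (C \<inter> D) dvd card P"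
    using card_subgroup_dvd[OF s sub(1)[OF assms(3)]] sub(2)[OF assms(3)] by auto
  then consider "card (C \<inter> D) = 1" | "card (C \<inter> D) = card P" using assms(2) by (metis prime_nat_iff)
  then show ?thesis
  proof cases
    case 1
    then show ?thesis using subgroup.one_closed[OF s] by (metis card_1_singletonE singletonD)
  next
    case 2
    have "C \<inter> D = C"
      using 2 sub(2)[OF assms(3)] by (intro card_subset_eq[OF finX[OF assms(3)]]) auto
    moreover have "C \<inter> D = D"
      using 2 sub(2)[OF assms(4)] by (intro card_subset_eq[OF finX[OF assms(4)]]) auto
    ultimately show ?thesis using assms(5) by simp
  qed
qed

text \<open>\<open>C\<close> and \<open>A\<close> have the same orbit, hence normalizers of the same
  order. As \<open>C\<close> lies in its own normalizer and \<open>card C = card A\<close>,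
  comparing orders suffices.\<close>

lemma conj_stab_conjugate:
  assumes "subgroup A G" "conj_stab (carrier G) A = A" "C \<in> conjugates A"
  shows "conj_stab (carrier G) C = C"
proof -
  have Ac: "A \<subseteq> carrier G" using assms(1) subgroup.subset by auto
  obtain g where g: "g \<in> carrier G" "C = conj_set g A" using assms(3) by (auto simp: conj_orbit_def)
  have sC: "subgroup C G" using g conj_set_subgroup assms(1) by auto
  have Cc: "C \<subseteq> carrier G" using sC subgroup.subset by auto
  have "conjugates C = conjugates A"
  proof
    show "conjugates C \<subseteq> conjugates A"
      using conj_orbit_closed[OF subgroup_self Ac assms(3)] by (auto simp: conj_orbit_def)
    show "conjugates A \<subseteq> conjugates C"
      using conj_orbit_closed[OF subgroup_self Cc conj_orbit_sym[OF subgroup_self Ac assms(3)]]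
      by (auto simp: conj_orbit_def)
  qed
  then have "card (conj_stab (carrier G) C) = card A"
    using conj_orbit_stabilizer[OF subgroup_self fin Ac] conj_orbit_stabilizer[OF subgroup_self fin Cc]
      card_conjugates_pos[of A] assms(2)
    by (metis mult_left_cancel less_not_refl)
  also have "\<dots> = card C" using g card_conj_set[OF g(1) Ac] by simp
  finally show ?thesis
    using subgroup_subset_conj_stab[OF sC] fin
    by (metis (no_types, lifting) card_subset_eq conj_stab_def finite_subset mem_Collect_eq subsetI)
qed

text \<open>Such an \<open>A\<close> would be a Frobenius complement. Its conjugates leave a set \<open>F\<close> of only \<open>m\<close>
  elements, which has to contain all Sylow \<open>p\<close>-subgroups for every prime \<open>p\<close> dividing \<open>m\<close>.\<close>

lemma no_abelian_frobenius_complement: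
  assumes A: "subgroup A G" "A \<noteq> {\<one>}"
    and comm: "\<And>x y. \<lbrakk>x \<in> A; y \<in> A\<rbrakk> \<Longrightarrow> x \<otimes> y = y \<otimes> x"
    and self: "conj_stab (carrier G) A = A"
    and cent: "\<And>x h. \<lbrakk>x \<in> A; x \<noteq> \<one>; h \<in> carrier G; h \<otimes> x = x \<otimes> h\<rbrakk> \<Longrightarrow> h \<in> A"
    and m: "card (conjugates A) = m" "m \<ge> 5" "m \<le> 15"
  shows False
proof -
  have Ac: "A \<subseteq> carrier G" using A subgroup.subset by auto
  have finA: "finite A" using Ac fin finite_subset by auto
  have n: "order G = m * card A"
    using conj_orbit_stabilizer[OF subgroup_self fin Ac] self m by (simp add: order_def)
  \<comment> \<open>Each conjugate of \<open>A\<close> is the full centralizer of each of its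
    nontrivial elements. The hypotheses \<open>cent\<close> and \<open>comm\<close> give this for
    \<open>A\<close>, and conjugation by \<open>g\<close> transports it.\<close>
  have cent': "C = {h \<in> carrier G. h \<otimes> x = x \<otimes> h}" if C: "C \<in> conjugates A" "x \<in> C" "x \<noteq> \<one>" for C x
  proof -
    obtain g where g: "g \<in> carrier G" "C = conj_set g A" using C(1) by (auto simp: conj_orbit_def)
    obtain y where y: "y \<in> A" "x = g \<otimes> y \<otimes> inv g" using C(2) g by (auto simp: conj_set_def)
    have yc: "y \<in> carrier G" using y Ac by auto
    have "y \<noteq> \<one>" using y C(3) g by auto
    have "A = {h \<in> carrier G. h \<otimes> y = y \<otimes> h}"
      using cent[OF y(1) \<open>y \<noteq> \<one>\<close>] comm[OF _ y(1)] Ac by auto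
    also have "\<dots> = conj_stab (carrier G) {y}"
      using conj_set_singleton_iff[OF _ yc] by (auto simp: conj_stab_def)
    finally have "A = conj_stab (carrier G) {y}" .
    moreover have "h \<in> C \<longleftrightarrow> conj_set (inv g) {h} \<subseteq> A" if "h \<in> carrier G" for h
    proof -
      have "h \<in> C \<longleftrightarrow> {h} \<subseteq> conj_set g A" using g by simp
      also have "\<dots> \<longleftrightarrow> conj_set (inv g) {h} \<subseteq> A"
      proof
        assume "{h} \<subseteq> conj_set g A"
        then have "conj_set (inv g) {h} \<subseteq> conj_set (inv g) (conj_set g A)" by (rule conj_set_mono)
        then show "conj_set (inv g) {h} \<subseteq> A" using conj_set_inv(1)[OF g(1) Ac] by simp
      next
        assume "conj_set (inv g) {h} \<subseteq> A"
        then have "conj_set g (conj_set (inv g) {h}) \<subseteq> conj_set g A" by (rule conj_set_mono)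
        then show "{h} \<subseteq> conj_set g A" using conj_set_inv(2)[OF g(1), of "{h}"] that by simp
      qed
      finally show ?thesis .
    qed
    moreover have "inv g \<otimes> h \<otimes> inv (inv g) \<in> conj_stab (carrier G) {y} \<longleftrightarrow> h \<otimes> x = x \<otimes> h" if h: "h \<in> carrier G" for h
    proof -
      let ?k = "inv g \<otimes> h \<otimes> inv (inv g)"
      have x: "{x} = conj_set g {y}" using y by (simp add: conj_set_def)
      have kc: "?k \<in> carrier G" using g h by simp
      have gk: "g \<otimes> ?k = h \<otimes> g" using g(1) h by (simp add: m_assoc[symmetric])
      have "h \<otimes> x = x \<otimes> h \<longleftrightarrow> conj_set h {x} = {x}"
        using conj_set_singleton_iff[OF h] y yc g(1) by simp
      also have "conj_set h {x} = conj_set g (conj_set ?k {y})"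
        unfolding x using g(1) h yc kc gk by (simp add: conj_set_mult)
      also have "(conj_set g (conj_set ?k {y}) = {x}) = (conj_set ?k {y} = {y})"
      proof
        assume "conj_set g (conj_set ?k {y}) = {x}"
        then have "conj_set (inv g) (conj_set g (conj_set ?k {y})) = conj_set (inv g) (conj_set g {y})"
          using x by simp
        then show "conj_set ?k {y} = {y}"
          using conj_set_inv(1)[OF g(1)] conj_set_closed[OF kc] yc by simp
      qed (use x in simp)
      finally show ?thesis using kc by (simp add: conj_stab_def)
    qed
    ultimately have "h \<in> C \<longleftrightarrow> h \<otimes> x = x \<otimes> h" if "h \<in> carrier G" for h
      using that by (auto simp: conj_set_def)
    moreover have "C \<subseteq> carrier G" using C(1) conj_orbit_subset[OF order.refl Ac] by auto
    ultimately show ?thesis by blast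
  qed
  have sC: "subgroup C G" "card C = card A" if "C \<in> conjugates A" for C
    using that conj_set_subgroup A(1) card_conj_set Ac by (auto simp: conj_orbit_def)
  \<comment> \<open>Two conjugates sharing an element other than \<open>\<one>\<close> would both be
    the centralizer of that element.\<close>
  have TI: "C \<inter> D = {\<one>}" if CD: "C \<in> conjugates A" "D \<in> conjugates A" "C \<noteq> D" for C D
  proof -
    have "x = \<one>" if "x \<in> C" "x \<in> D" for x
      using cent'[OF CD(1) that(1)] cent'[OF CD(2) that(2)] CD(3) by blast
    moreover have "\<one> \<in> C" "\<one> \<in> D" using sC CD subgroup.one_closed by auto
    ultimately show ?thesis by blast
  qed
  \<comment> \<open>A subgroup \<open>T\<close> of order \<open>p\<close> in \<open>A\<close> acts
    on the conjugates of \<open>A\<close> and fixes only \<open>A\<close>: if it fixes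
    \<open>B\<close>, then \<open>T\<close> lies in the normalizer of \<open>B\<close>, which is
    \<open>B\<close>, while \<open>B\<close> and \<open>A\<close> intersect trivially unless they
    are equal.\<close>
  have mp: "m mod p = 1" if p: "prime p" "p dvd card A" for p :: nat
  proof -
    obtain T where T: "subgroup T G" "card T = p ^ 1" "T \<subseteq> A"
      using sylow_subgroup_exists_in[OF fin A(1) p(1), of 1] p(2) by auto
    have Tc: "T \<subseteq> carrier G" using T Ac by auto
    have "T \<noteq> {\<one>}" using T(2) prime_gt_1_nat[OF p(1)] by auto
    then obtain t where t: "t \<in> T" "t \<noteq> \<one>" using subgroup.one_closed[OF T(1)] by blast
    have "[card (conjugates A) = card {B \<in> conjugates A. \<forall>g\<in>T. conj_set g B = B}] (mod p)"
    proof (rule card_fixed_points_cong[OF T(1) _ T(2) p(1) finite_conjugates])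
      show "finite T" using Tc fin finite_subset by auto
      show "conjugates A \<subseteq> Pow (carrier G)" using conj_orbit_subset[OF order.refl Ac] by blast
      show "conj_set g B \<in> conjugates A" if "g \<in> T" "B \<in> conjugates A" for g B
        using that conj_orbit_closed[OF subgroup_self Ac] Tc by blast
    qed
    moreover have "{B \<in> conjugates A. \<forall>g\<in>T. conj_set g B = B} = {A}"
    proof -
      have "B = A" if B: "B \<in> conjugates A" "\<forall>g\<in>T. conj_set g B = B" for B
      proof (rule ccontr)
        assume "B \<noteq> A"
        have "t \<in> conj_stab (carrier G) B" using B(2) t Tc by (auto simp: conj_stab_def)
        then have "t \<in> B \<inter> A" using conj_stab_conjugate[OF A(1) self B(1)] t T(3) by auto
        then show False
          using TI[OF B(1) conj_orbit_self[OF subgroup_self Ac] \<open>B \<noteq> A\<close>] t(2) by auto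
      qed
      moreover have "\<forall>g\<in>T. conj_set g A = A"
        using subgroup_subset_conj_stab[OF A(1)] T(3) by (auto simp: conj_stab_def)
      ultimately show ?thesis using conj_orbit_self[OF subgroup_self Ac] by auto
    qed
    ultimately show ?thesis using m(1) prime_gt_1_nat[OF p(1)] by (simp add: cong_def)
  qed
  define U where "U = (\<Union>C\<in>conjugates A. C - {\<one>})"
  \<comment> \<open>\<open>F\<close> is what would be the Frobenius kernel. It contains
    \<open>\<one>\<close>, and its size is \<open>m * card A - m * (card A - 1) = m\<close>. That it
    is a subgroup is never shown.\<close>
  define F where "F = carrier G - U"
  have Uc: "U \<subseteq> carrier G" unfolding U_def using conj_orbit_subset[OF order.refl Ac] by blast
  have finF: "finite F" unfolding F_def using fin by simp
  have "card U = m * (card A - 1)" unfolding U_def using card_union_conjugates[OF A(1) TI] m(1) by simp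
  moreover have "card A > 0" using finA subgroup.one_closed[OF A(1)] by (auto simp: card_gt_0_iff)
  ultimately have cF: "card F = m"
    unfolding F_def using card_Diff_subset[OF finite_subset[OF Uc fin] Uc] n
    by (simp add: order_def diff_mult_distrib2)
  have "card A \<noteq> 1" using A subgroup.one_closed[OF A(1)] by (metis card_1_singletonE singletonD)
  then have a2: "card A \<ge> 2" using \<open>card A > 0\<close> by linarith
  \<comment> \<open>By \<open>mp\<close> a prime dividing \<open>m\<close> cannot divide
    \<open>card A\<close>. So the full power of \<open>p\<close> in the order of the group is that
    in \<open>m\<close>, and Sylow \<open>p\<close>-subgroups meet every conjugate of
    \<open>A\<close> trivially.\<close>
  have key: "\<exists>P. subgroup P G \<and> card P = p ^ e \<and> card (conjugates P) \<ge> 5 \<and> card (conjugates P) mod p = 1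
      \<and> (\<forall>Q\<in>conjugates P. Q \<subseteq> F)"
    if p: "prime p" "e > 0" "p ^ e dvd m" "\<not> p ^ Suc e dvd m" for p e :: nat
  proof -
    have pm: "p dvd m" using p(2,3) by (meson dvd_power dvd_trans)
    have "\<not> p dvd card A" using mp[OF p(1)] pm by (auto simp: mod_eq_0_iff_dvd)
    then have cop: "coprime p (card A)" using p(1) prime_imp_coprime by blast
    have ns: "\<not> p ^ Suc e dvd order G"
      using n p(4) cop by (metis coprime_dvd_mult_left_iff coprime_power_left_iff)
    obtain P where P: "subgroup P G" "card P = p ^ e"
      using sylow_subgroup_exists[OF fin p(1), of e] n p(3) by (metis dvd_mult2)
    have Pc: "P \<subseteq> carrier G" using subgroup.subset[OF P(1)] .
    have "p ^ e > 1" using one_less_power[OF prime_gt_1_nat[OF p(1)] p(2)] .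
    then have P1: "P \<noteq> {\<one>}" using P(2) by auto
    have "p ^ e \<le> m" using p(3) m(2) by (intro dvd_imp_le) auto
    moreover have "m < order G" using n a2 m(2) by auto
    ultimately have PG: "P \<noteq> carrier G" using P(2) by (auto simp: order_def)
    have "Q \<subseteq> F" if Q: "Q \<in> conjugates P" for Q
    proof -
      have sQ: "subgroup Q G" "card Q = p ^ e"
        using Q conj_set_subgroup P card_conj_set Pc by (auto simp: conj_orbit_def)
      have "Q \<inter> C = {\<one>}" if "C \<in> conjugates A" for C
        using coprime_subgroups_trivial_Int[OF sQ(1) sC(1)[OF that]] sQ(2) sC(2)[OF that] cop by simp
      then show ?thesis using subgroup.subset[OF sQ(1)] by (auto simp: F_def U_def)
    qed
    then show ?thesis using P card_conjugates_sylow_cong[OF p(1) P ns P1 PG] by blast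
  qed
  \<comment> \<open>The \<open>s\<close> Sylow subgroups of order \<open>p\<close> contribute
    \<open>s * (p - 1)\<close> distinct nontrivial elements to \<open>F\<close>, which has only
    \<open>m - 1\<close> of them.\<close>
  have prime_case: "\<exists>s. s \<ge> 5 \<and> s mod p = 1 \<and> s * (p - 1) \<le> m - 1"
    if p: "prime p" "p dvd m" "\<not> p ^ 2 dvd m" for p :: nat
  proof -
    have "\<not> p ^ Suc 1 dvd m" using p(3) by (simp add: power2_eq_square)
    then obtain P where P: "subgroup P G" "card P = p" "card (conjugates P) \<ge> 5" "card (conjugates P) mod p = 1"
      "\<forall>Q\<in>conjugates P. Q \<subseteq> F" using key[OF p(1), of 1] p(2) by auto
    have "card (conjugates P) * (p - 1) = card (\<Union>C\<in>conjugates P. C - {\<one>})"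
      using card_union_conjugates[OF P(1) prime_order_conjugates_TI[OF P(1)]] P(2) p(1) by simp
    also have "\<dots> \<le> card (F - {\<one>})"
      using P(5) finF by (intro card_mono) auto
    also have "\<dots> = m - 1" using cF by (simp add: F_def U_def)
    finally show ?thesis using P by blast
  qed
  \<comment> \<open>Here a Sylow subgroup has as many elements as \<open>F\<close> and therefore
    equals \<open>F\<close>, so it is unique, against the bound of 5 conjugates.\<close>
  have power_case: False if p: "prime p" "e > 0" "m = p ^ e" for p e :: nat
  proof -
    have "\<not> p ^ Suc e dvd m" using p m(2) prime_gt_1_nat[OF p(1)] by (auto dest!: dvd_imp_le)
    then obtain P where P: "subgroup P G" "card P = m" "card (conjugates P) \<ge> 5"
      "\<forall>Q\<in>conjugates P. Q \<subseteq> F" using key[OF p(1,2)] p(3) by auto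
    have Pc: "P \<subseteq> carrier G" using subgroup.subset[OF P(1)] .
    have "Q = F" if "Q \<in> conjugates P" for Q
      using that P(2,4) cF finF card_conj_set[OF _ Pc] by (intro card_subset_eq) (auto simp: conj_orbit_def)
    then have "conjugates P \<subseteq> {F}" by auto
    then have "card (conjugates P) \<le> card {F}" by (rule card_mono[rotated]) simp
    then show False using P(3) by simp
  qed
  consider "m = 5" | "m = 6" | "m = 7" | "m = 8" | "m = 9" | "m = 10" | "m = 11" | "m = 12" | "m = 13" | "m = 14" | "m = 15"
  proof -
    have "m = 5 \<or> m = 6 \<or> m = 7 \<or> m = 8 \<or> m = 9 \<or> m = 10 \<or> m = 11 \<or> m = 12 \<or> m = 13 \<or> m = 14 \<or> m = 15"
      using m(2,3) by presburger
    then show ?thesis using that by blast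
  qed
  then show False
  proof cases
    case 1 then show False using power_case[of 5 1] by simp
  next
    case 2 then show False using prime_case[of 3] by auto
  next
    case 3 then show False using power_case[of 7 1] by simp
  next
    case 4 then show False using power_case[of 2 3] by simp
  next
    case 5 then show False using power_case[of 3 2] by simp
  next
    case 6 then show False using prime_case[of 5] by auto
  next
    case 7 then show False using power_case[of 11 1] by simp
  next
    \<comment> \<open>For \<open>m = 12\<close> the size bound alone still allows
      \<open>s = 5\<close>; the congruence modulo 3 is needed. In the other applications of
      \<open>prime_case\<close>, \<open>s \<ge> 5\<close> already gives too many elements.\<close>
    case 8
    then obtain s where s: "s \<ge> 5" "s mod 3 = 1" "s * 2 \<le> (11::nat)" using prime_case[of 3] by auto
    then have "s = 5" by linarith
    then show False using s(2) by simp
  next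
    case 9 then show False using power_case[of 13 1] by simp
  next
    case 10 then show False using prime_case[of 7] by auto
  next
    case 11 then show False using prime_case[of 5] by auto
  qed
qed

end

section \<open>Orbit sizes of abelian covers\<close>

context abelian_cover
begin

section \<open>Covers with two orbits\<close>

text \<open>The equation \<open>eq\<close> says that \<open>A\<close> is its own normalizer. Since
  its index is at most 15 and classes have size at least 5, the centralizer of a nontrivial element
  of \<open>A\<close> is larger than \<open>A\<close> by a factor of at most 3. Once the factors 2
  and 3 are excluded, \<open>no_abelian_frobenius_complement\<close> applies.\<close>

lemma no_self_normalizing_pair:
  assumes A: "A \<in> \<A>" and B: "B \<in> \<A>" and cov: "\<A> = conjugates A \<union> conjugates B"
    and le: "card (conjugates A) + card (conjugates B) \<le> 20"
    and eq: "card (conjugates A) * card A = order G"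
  shows False
proof -
  let ?m = "card (conjugates A)"
  have sA: "subgroup A G" and Ac: "A \<subseteq> carrier G" using A cover_subgroup cover_subset by auto
  have m15: "?m \<le> 15" using le cover_orbit_ge_5[OF B] by simp
  have mpos: "?m > 0" by (rule card_conjugates_pos)
  have apos: "card A > 0" using cover_card_ge_2[OF A] by simp
  have self: "conj_stab (carrier G) A = A"
  proof -
    have "card (conj_stab (carrier G) A) = card A"
      using conj_orbit_stabilizer[OF subgroup_self fin Ac] eq mpos
      by (metis mult_left_cancel less_not_refl order_def)
    moreover have "finite (conj_stab (carrier G) A)" using fin by (simp add: conj_stab_def)
    ultimately show ?thesis using card_subset_eq[OF _ subgroup_subset_conj_stab[OF sA]] by simp
  qed
  have "S = A" if x: "x \<in> A" "x \<noteq> \<one>" and S: "S = conj_stab (carrier G) {x}" for x S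
  proof -
    have xc: "x \<in> carrier G" using x Ac by auto
    have sS: "subgroup S G" unfolding S using conj_stab_subgroup[OF subgroup_self] xc by simp
    have finS: "finite S" using fin S by (simp add: conj_stab_def)
    have AS: "A \<subseteq> S"
      unfolding S using conj_set_singleton_iff[OF _ xc] cover_comm[OF A _ x(1)] Ac by (auto simp: conj_stab_def)
    then obtain r where r: "card S = card A * r" using card_subgroup_dvd[OF sA sS] by (auto simp: dvd_def)
    let ?d = "card (conjugates {x})"
    have d5: "?d \<ge> 5" using card_conjugates_ge_5 conjugates_singleton_nontrivial[OF xc x(2)] xc by simp
    have dS: "?d * card S = order G"
      using conj_orbit_stabilizer[OF subgroup_self fin, of "{x}"] xc S by (simp add: order_def)
    then have "?d * r * card A = ?m * card A" using eq r by (simp add: ac_simps)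
    then have dr: "?d * r = ?m" using apos by simp
    have "r \<le> 3"
    proof (rule ccontr)
      assume "\<not> r \<le> 3"
      then have "5 * 4 \<le> ?d * r" using d5 by (intro mult_le_mono) auto
      then show False using dr m15 by simp
    qed
    moreover have "r \<noteq> 0" using dr mpos by (metis mult_0_right less_not_refl)
    \<comment> \<open>A subgroup of index 2 is normal, but \<open>A\<close> is its own normalizer.
      In terms of orbits: \<open>A\<close> must fix its only other \<open>S\<close>-conjugate
      \<open>A'\<close>, and \<open>A'\<close> is self-normalizing too, so \<open>A\<close> lies in
      \<open>A'\<close>.\<close>
    moreover have "r \<noteq> 2"
    proof
      assume "r = 2"
      have "conj_stab S A = A"
        using self AS subgroup.subset[OF sS] by (auto simp: conj_stab_def)
      then have "card (conj_orbit S A) * card A = card S"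
        using conj_orbit_stabilizer[OF sS finS Ac] by simp
      then have "card (conj_orbit S A) = 2" using r \<open>r = 2\<close> apos by simp
      moreover have AO: "A \<in> conj_orbit S A" using conj_orbit_self[OF sS Ac] .
      ultimately obtain u v where uv: "conj_orbit S A = {u, v}" "u \<noteq> v" "A = u \<or> A = v"
        by (metis card_2_iff insertE singletonD)
      then obtain A' where A': "conj_orbit S A = {A, A'}" "A' \<noteq> A"
        by (metis insert_commute)
      have "A' \<in> conj_orbit S A" using A'(1) by simp
      then have "A' \<in> conjugates A" using subgroup.subset[OF sS] unfolding conj_orbit_def by blast
      have A'c: "A' \<subseteq> carrier G" using conj_orbit_subset[OF order.refl Ac \<open>A' \<in> conjugates A\<close>] .
      have "A \<subseteq> conj_stab (carrier G) A'"
      proof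
        fix y assume y: "y \<in> A"
        then have yc: "y \<in> carrier G" using Ac by auto
        have "conj_set y A' \<in> {A, A'}"
          using conj_orbit_closed[OF sS Ac, of A' y] A'(1) y AS by auto
        moreover have "conj_set y A' \<noteq> A"
        proof
          assume "conj_set y A' = A"
          moreover have "conj_set y A = A"
            using y subgroup_subset_conj_stab[OF sA] by (auto simp: conj_stab_def)
          ultimately show False using conj_set_inv(1)[OF yc] A'c Ac A'(2) by metis
        qed
        ultimately show "y \<in> conj_stab (carrier G) A'" using yc by (simp add: conj_stab_def)
      qed
      also have "\<dots> = A'" by (rule conj_stab_conjugate[OF sA self \<open>A' \<in> conjugates A\<close>])
      finally have "A \<subseteq> A'" .
      moreover have "card A' = card A"
        using \<open>A' \<in> conjugates A\<close> card_conj_set[OF _ Ac] by (auto simp: conj_orbit_def)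
      ultimately have "A = A'" using A'c fin by (metis card_subset_eq finite_subset)
      then show False using A'(2) by simp
    qed
    \<comment> \<open>Equality holds throughout: the class has size 5 and the orbits have sizes 15
      and 5. The class makes the order divide 60, so 5 divides it exactly once, but neither 15 nor 5
      has a divisor \<open>d \<ge> 5\<close> congruent to 1 modulo 5.\<close>
    moreover have "r \<noteq> 3"
    proof
      assume "r = 3"
      then have dm: "?d = 5" "?m = 15" using dr d5 m15 by auto
      then have mB: "card (conjugates B) = 5" using le cover_orbit_ge_5[OF B] by simp
      have "2 * order G dvd fact 5"
        using order_dvd_fact_conjugates[of "{x}"] xc dm(1) by simp
      also have "fact 5 = 2 * (60::nat)" by (simp add: fact_numeral)
      finally have n60: "order G dvd 60" by simp
      have "5 dvd order G" using dS dm(1) by (metis dvd_triv_left)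
      moreover have "\<not> 5 ^ 2 dvd order G"
        using n60 by (auto dest: dvd_trans)
      ultimately obtain d :: nat where d: "d dvd 15 \<or> d dvd 5" "d mod 5 = 1" "d \<ge> 5"
        using cover_prime_divisor[of 5 "[A, B]"] A B cov dm(2) mB by auto
      then have "d dvd 15" using dvd_trans[of d 5 15] by auto
      then have "d \<le> 15" by (auto dest: dvd_imp_le)
      then have "d = 6 \<or> d = 11" using d(2,3) by presburger
      then show False using \<open>d dvd 15\<close> by auto
    qed
    ultimately have "r = 1" by linarith
    then show "S = A" using r AS finS by (metis card_subset_eq mult.right_neutral)
  qed
  then have "h \<in> A" if "x \<in> A" "x \<noteq> \<one>" "h \<in> carrier G" "h \<otimes> x = x \<otimes> h" for x h
    using that conj_set_singleton_iff[of h x] Ac by (auto simp: conj_stab_def)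
  then show False
    using no_abelian_frobenius_complement[OF sA cover_nontrivial[OF A] cover_comm[OF A] self _ refl cover_orbit_ge_5[OF A] m15]
    by blast
qed

text \<open>If neither \<open>A\<close> nor \<open>B\<close> is its own normalizer, then
  \<open>card (conjugates A) * card A\<close> and the same product for \<open>B\<close> are at most
  half of the order. Removing the identity from each conjugate leaves too few elements to cover the
  group.\<close>

lemma not_two_orbits:
  assumes A: "A \<in> \<A>" and B: "B \<in> \<A>" and cov: "\<A> = conjugates A \<union> conjugates B"
    and le: "card (conjugates A) + card (conjugates B) \<le> 20"
  shows False
proof -
  have half: "2 * (card (conjugates X) * card X) \<le> order G"
    if X: "X \<in> \<A>" "card (conjugates X) * card X \<noteq> order G" for X
  proof -
    obtain k where k: "order G = card (conjugates X) * card X * k"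
      using cover_card_dvd[OF X(1)] by (auto simp: dvd_def)
    have "k \<noteq> 0" "k \<noteq> 1" using k X(2) order_gt_one by (metis mult_0_right not_one_less_zero, metis mult.right_neutral)
    then have "2 \<le> k" by simp
    then show ?thesis unfolding k by simp
  qed
  have nA: "card (conjugates A) * card A \<noteq> order G"
    using no_self_normalizing_pair[OF A B cov le] by blast
  have nB: "card (conjugates B) * card B \<noteq> order G"
    using no_self_normalizing_pair[OF B A] cov le by (auto simp: Un_commute add.commute)
  have "order G \<le> 1 + (card (conjugates A) * (card A - 1) + card (conjugates B) * (card B - 1))"
    using order_le_sum[of "[A, B]"] A B cov by simp
  moreover have "card (conjugates A) * (card A - 1) = card (conjugates A) * card A - card (conjugates A)"
    "card (conjugates B) * (card B - 1) = card (conjugates B) * card B - card (conjugates B)"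
    by (simp_all add: diff_mult_distrib2)
  ultimately show False
    using half[OF A nA] half[OF B nB] cover_orbit_ge_5[OF A] cover_orbit_ge_5[OF B] order_gt_one by linarith
qed

section \<open>Covers with three orbits\<close>

text \<open>There must be six Sylow 5-subgroups. If \<open>card A\<close> were larger than 5, then
  \<open>A\<close> would contain a subgroup \<open>Y\<close> of order 2 or 3 commuting with the
  Sylow subgroup \<open>T\<close>. The set \<open>X\<close> of Sylow 5-subgroups fixed by
  \<open>Y\<close> has size divisible by 2 or 3, because 6 is, and size 1 modulo 5, because
  \<open>T\<close> acts on it with \<open>T\<close> as its only fixed point. So \<open>Y\<close>
  fixes all six, against faithfulness.\<close>

lemma order_5_self_centralizing:
  assumes A: "A \<in> \<A>" and n360: "order G dvd 360" and a5: "5 dvd card A"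
    and m: "card (conjugates A) = 6 \<or> card (conjugates A) = 8"
  shows "card (conjugates A) * card A = 30"
proof -
  have sA: "subgroup A G" and Ac: "A \<subseteq> carrier G" using A cover_subgroup cover_subset by auto
  have n25: "\<not> 5 ^ 2 dvd order G" using n360 by (auto dest: dvd_trans)
  obtain T where T: "subgroup T G" "card T = 5" "T \<subseteq> A"
    using sylow_subgroup_exists_in[OF fin sA, of 5 1] a5 by auto
  have Tc: "T \<subseteq> carrier G" using T Ac by auto
  let ?s = "card (conjugates T)"
  have s: "?s dvd card (conjugates A)" "?s mod 5 = 1" "?s \<ge> 5"
    using sylow_in_cover[OF _ n25 A T] by auto
  have "?s \<le> 8" using s(1) m by (auto dest: dvd_imp_le)
  then have s6: "?s = 6" using s(2,3) by presburger
  then have m6: "card (conjugates A) = 6" using s(1) m by auto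
  have "card A = 5"
  proof (rule ccontr)
    assume "card A \<noteq> 5"
    obtain b where b: "card A = 5 * b" using a5 by (auto simp: dvd_def)
    have "b \<noteq> 1" using b \<open>card A \<noteq> 5\<close> by simp
    then obtain q where q: "prime q" "q dvd b" using prime_factor_nat by blast
    have "6 * (5 * b) dvd 360"
      using dvd_trans[OF cover_card_dvd[OF A] n360] m6 b by simp
    then have "30 * b dvd 30 * 12" by simp
    then have "b dvd 12" by (rule dvd_times_left_cancel_iff[THEN iffD1, rotated]) simp
    then have "q dvd 12" using q(2) dvd_trans by blast
    then have "q dvd 2 ^ 2 * 3" by simp
    then have "q dvd 2 \<or> q dvd 3"
      using q(1) prime_dvd_mult_iff[of q "2 ^ 2" 3] prime_dvd_power[of q 2 2] by blast
    then have q23: "q = 2 \<or> q = 3"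
      using q(1) primes_dvd_imp_eq[of q 2] primes_dvd_imp_eq[of q 3] by auto
    obtain Y where Y: "subgroup Y G" "card Y = q ^ 1" "Y \<subseteq> A"
      using sylow_subgroup_exists_in[OF fin sA q(1), of 1] q(2) b by auto
    have Yc: "Y \<subseteq> carrier G" using Y Ac by auto
    have "Y \<noteq> {\<one>}" using Y(2) prime_gt_1_nat[OF q(1)] by auto
    then obtain y where y: "y \<in> Y" "y \<noteq> \<one>" using subgroup.one_closed[OF Y(1)] by blast
    define X where "X = {B \<in> conjugates T. \<forall>g\<in>Y. conj_set g B = B}"
    have OP: "conjugates T \<subseteq> Pow (carrier G)" using conj_orbit_subset[OF order.refl Tc] by blast
    have "[?s = card X] (mod q)" unfolding X_def
    proof (rule card_fixed_points_cong[OF Y(1) _ Y(2) q(1) finite_conjugates OP])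
      show "finite Y" using Yc fin finite_subset by auto
      show "conj_set g B \<in> conjugates T" if "g \<in> Y" "B \<in> conjugates T" for g B
        using that conj_orbit_closed[OF subgroup_self Tc] Yc by blast
    qed
    then have "q dvd card X" using q23 s6 by (auto simp: cong_def)
    have "[card X = card {B \<in> X. \<forall>g\<in>T. conj_set g B = B}] (mod 5)"
    proof (rule card_fixed_points_cong[OF T(1), of 5 1])
      show "finite T" using Tc fin finite_subset by auto
      show "finite X" unfolding X_def using finite_conjugates by simp
      show "X \<subseteq> Pow (carrier G)" using OP X_def by auto
      show "conj_set t B \<in> X" if t: "t \<in> T" and B: "B \<in> X" for t B
      proof -
        have tc: "t \<in> carrier G" and Bc: "B \<subseteq> carrier G" using t B Tc OP X_def by auto
        have "conj_set g (conj_set t B) = conj_set t B" if g: "g \<in> Y" for g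
        proof -
          have "g \<otimes> t = t \<otimes> g" using cover_comm[OF A] g t T(3) Y(3) by auto
          then have "conj_set g (conj_set t B) = conj_set t (conj_set g B)"
            using g Yc tc Bc by (simp add: conj_set_mult subset_iff)
          then show ?thesis using B g X_def by auto
        qed
        moreover have "conj_set t B \<in> conjugates T"
          using conj_orbit_closed[OF subgroup_self Tc] B tc X_def by auto
        ultimately show ?thesis by (simp add: X_def)
      qed
    qed (use T in auto)
    moreover have "{B \<in> X. \<forall>g\<in>T. conj_set g B = B} = {T}"
    proof -
      have "B = T" if B: "B \<in> X" "\<forall>g\<in>T. conj_set g B = B" for B
      proof -
        have "subgroup B G" "card B = 5 ^ 1"
          using B(1) conj_set_subgroup T card_conj_set Tc by (auto simp: X_def conj_orbit_def)
        then show ?thesis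
          using sylow_normalizing_eq[OF fin, of 5 1 T B] n25 T B(2) by (simp add: power2_eq_square)
      qed
      moreover have "\<forall>g\<in>T. conj_set g T = T"
        using subgroup_subset_conj_stab[OF T(1)] by (auto simp: conj_stab_def)
      moreover have "conj_set g T = T" if "g \<in> Y" for g
        using commuting_conj_set[of g T] that Yc Tc cover_comm[OF A] T(3) Y(3) by blast
      ultimately show ?thesis using conj_orbit_self[OF subgroup_self Tc] by (auto simp: X_def)
    qed
    ultimately have X1: "card X mod 5 = 1" by (simp add: cong_def)
    have "card X \<le> 6" unfolding X_def s6[symmetric] using finite_conjugates by (intro card_mono) auto
    then have "card X = 1 \<or> card X = 6" using X1 by presburger
    then have "card X = card (conjugates T)" using \<open>q dvd card X\<close> q23 s6 by auto
    then have "X = conjugates T" using finite_conjugates by (intro card_subset_eq) (auto simp: X_def)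
    then have "conj_set y C = C" if "C \<in> conjugates T" for C using that y X_def by auto
    then have "y = \<one>" using conjugation_faithful[OF Tc] s6 y Yc by auto
    then show False using y by simp
  qed
  then show ?thesis using m6 by simp
qed

text \<open>Three sizes of at least 7 would sum to 21, so 6 occurs and the order divides 360. The
  arithmetic then leaves only the orders 90, 180 and 360, and for these the cover has too few
  elements.\<close>

lemma not_three_orbits_ge_6:
  assumes set: "set [A, B, C] \<subseteq> \<A>" and cov: "\<A> = (\<Union>X\<in>set [A, B, C]. conjugates X)"
    and le: "card (conjugates A) + card (conjugates B) + card (conjugates C) \<le> 20"
    and ge: "\<And>X. X \<in> set [A, B, C] \<Longrightarrow> card (conjugates X) \<ge> 6"
  shows False
proof -
  let ?m = "\<lambda>X. card (conjugates X)"
  have sub: "X \<subseteq> carrier G" "?m X \<noteq> 1" "X \<in> \<A>" if "X \<in> set [A, B, C]" for X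
    using that set cover_subset cover_orbit_nontrivial by auto
  have ge': "?m A \<ge> 6" "?m B \<ge> 6" "?m C \<ge> 6" using ge by auto
  then have "\<exists>X\<in>set [A, B, C]. ?m X = 6" using le by (auto; presburger)
  then obtain X where X: "X \<in> set [A, B, C]" "?m X = 6" by blast
  have "2 * order G dvd fact 6"
    using order_dvd_fact_conjugates[OF sub(1,2)[OF X(1)]] X(2) by simp
  also have "fact 6 = 2 * (360::nat)" by (simp add: fact_numeral)
  finally have n360: "order G dvd 360" by simp
  have n6: "6 dvd order G" using card_conj_orbit_dvd_order[OF fin sub(1)[OF X(1)]] X(2) by simp
  have m68: "?m Y = 6 \<or> ?m Y = 8" if Y: "Y \<in> set [A, B, C]" for Y
  proof -
    have "?m Y \<le> 8" using Y le ge' by auto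
    moreover have "?m Y \<noteq> 7"
    proof
      assume "?m Y = 7"
      then have "7 dvd (360::nat)"
        using card_conj_orbit_dvd_order[OF fin sub(1)[OF Y]] n360 by (metis dvd_trans)
      then show False by simp
    qed
    ultimately show ?thesis using ge[OF Y] by linarith
  qed
  \<comment> \<open>If 3 divided the order exactly once, some orbit size, 6 or 8, would have a
    divisor congruent to 1 modulo 3 between 5 and 8, that is, the divisor 7.\<close>
  have n9: "3 ^ 2 dvd order G"
  proof (rule ccontr)
    assume "\<not> 3 ^ 2 dvd order G"
    moreover have "3 dvd order G" using n6 by (auto intro: dvd_trans[of 3 6])
    ultimately obtain Y d where Y: "Y \<in> set [A, B, C]" "d dvd ?m Y" "d mod 3 = 1" "d \<ge> 5"
      using cover_prime_divisor[of 3 "[A, B, C]"] set cov by auto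
    have d68: "d dvd 6 \<or> d dvd 8" using m68[OF Y(1)] Y(2) by auto
    then have "d \<le> 8" by (auto dest: dvd_imp_le)
    then have "d = 7" using Y(3,4) by presburger
    then show False using d68 by auto
  qed
  \<comment> \<open>Without the factor 5 the order divides 72, so the number of Sylow 3-subgroups
    divides 8, is at least 5 and is 1 modulo 3; no such number exists.\<close>
  have n5: "5 dvd order G"
  proof (rule ccontr)
    assume "\<not> 5 dvd order G"
    then have "coprime (order G) 5" using prime_imp_coprime[of 5 "order G"] by (simp add: coprime_commute)
    moreover have "order G dvd 5 * 72" using n360 by simp
    ultimately have n72: "order G dvd 72" using coprime_dvd_mult_right_iff by blast
    then have n27: "\<not> 3 ^ Suc 2 dvd order G" by (auto dest: dvd_trans)
    obtain P where P: "subgroup P G" "card P = 3 ^ 2"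
      using sylow_subgroup_exists[OF fin, of 3 2] n9 by auto
    let ?s = "card (conjugates P)"
    have "P \<noteq> {\<one>}" using P(2) by auto
    moreover have "P \<noteq> carrier G"
    proof
      assume "P = carrier G"
      then have "order G = 9" using P(2) by (simp add: order_def)
      then show False using n6 by simp
    qed
    ultimately have s: "?s mod 3 = 1" "?s \<ge> 5"
      using card_conjugates_sylow_cong[of 3, OF _ P n27] by auto
    have "?s * 9 dvd 8 * 9"
      using dvd_trans[OF card_conj_orbit_mult_dvd[OF fin P(1)] n72] P(2) by simp
    then have s8: "?s dvd 8" by (rule dvd_times_right_cancel_iff[THEN iffD1, rotated]) simp
    then have "?s \<le> 8" by (auto dest: dvd_imp_le)
    then have "?s = 7" using s by presburger
    then show False using s8 by simp
  qed
  have "90 dvd order G"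
  proof -
    have "5 * 9 dvd order G" using n5 n9 by (intro divides_mult) (simp_all add: coprime_iff_gcd_eq_1 gcd_nat.simps)
    moreover have "2 dvd order G" using n6 by (auto intro: dvd_trans[of 2 6])
    moreover have "coprime 2 (45::nat)" by simp
    ultimately have "2 * 45 dvd order G" by (intro divides_mult) simp_all
    then show ?thesis by simp
  qed
  then obtain k where k: "order G = 90 * k" by (auto simp: dvd_def)
  then have "90 * k dvd 90 * 4" using n360 by simp
  then have "k dvd 4" by simp
  then have k4: "k = 1 \<or> k = 2 \<or> k = 4"
  proof -
    have "k \<le> 4" using \<open>k dvd 4\<close> by (auto dest: dvd_imp_le)
    moreover have "k \<noteq> 0" using k order_gt_one by (metis mult_0_right not_one_less_zero)
    moreover have "k \<noteq> 3" using \<open>k dvd 4\<close> by auto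
    ultimately show ?thesis by presburger
  qed
  \<comment> \<open>The value 30 comes from members of order divisible by 5, and
    \<open>18 * k\<close> is one fifth of the order, which bounds the product for the other members.
    The summand 6 accounts for the identity removed from at least 6 conjugates.\<close>
  have bound: "?m Y * (card Y - 1) + 6 \<le> max 30 (18 * k)" if Y: "Y \<in> set [A, B, C]" for Y
  proof -
    have "?m Y * card Y \<le> max 30 (18 * k)"
    proof (cases "5 dvd card Y")
      case True
      then show ?thesis using order_5_self_centralizing[OF sub(3)[OF Y] n360 True m68[OF Y]] by simp
    next
      case False
      have "\<not> 5 dvd ?m Y" using m68[OF Y] by auto
      then have "coprime 5 (?m Y * card Y)" using False by (simp add: prime_imp_coprime)
      then have "5 * (?m Y * card Y) dvd order G"
        using divides_mult[OF n5 cover_card_dvd[OF sub(3)[OF Y]]] by blast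
      then have "5 * (?m Y * card Y) \<le> order G" using order_gt_one by (intro dvd_imp_le) auto
      then show ?thesis using k by linarith
    qed
    moreover have "?m Y * (card Y - 1) = ?m Y * card Y - ?m Y" by (simp add: diff_mult_distrib2)
    moreover have "?m Y \<le> ?m Y * card Y" using cover_card_ge_2[OF sub(3)[OF Y]] by simp
    ultimately show ?thesis using ge[OF Y] by linarith
  qed
  \<comment> \<open>For \<open>k\<close> equal to 1, 2 and 4 the right-hand side is at most 73, 91
    and 199, against the orders 90, 180 and 360.\<close>
  have "order G \<le> 1 + (?m A * (card A - 1) + (?m B * (card B - 1) + ?m C * (card C - 1)))"
    using order_le_sum[OF set cov] by simp
  then show False using bound[of A] bound[of B] bound[of C] k4 k by auto
qed

text \<open>The orbit of size 5 makes the order divide 60. As no size exceeds 10, the prime 5 forces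
  an orbit of size 6, and then the prime 3 forces one of size 10. The three sizes differ, so
  together they already make 21.\<close>

lemma not_three_orbits_5:
  assumes set: "set [A, B, C] \<subseteq> \<A>" and cov: "\<A> = (\<Union>X\<in>set [A, B, C]. conjugates X)"
    and le: "card (conjugates A) + card (conjugates B) + card (conjugates C) \<le> 20"
    and X: "X \<in> set [A, B, C]" "card (conjugates X) = 5"
  shows False
proof -
  let ?m = "\<lambda>X. card (conjugates X)"
  have sub: "X \<subseteq> carrier G" "?m X \<noteq> 1" "?m X \<ge> 5" if "X \<in> set [A, B, C]" for X
    using that set cover_subset cover_orbit_nontrivial cover_orbit_ge_5 by auto
  have ge': "?m A \<ge> 5" "?m B \<ge> 5" "?m C \<ge> 5" using sub(3) by auto
  have le10: "?m Y \<le> 10" if Y: "Y \<in> set [A, B, C]" for Y using Y le ge' by auto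
  have "2 * order G dvd fact 5"
    using order_dvd_fact_conjugates[OF sub(1,2)[OF X(1)]] X(2) by simp
  also have "fact 5 = 2 * (60::nat)" by (simp add: fact_numeral)
  finally have n60: "order G dvd 60" by simp
  have dvd_n: "?m Y dvd order G" if "Y \<in> set [A, B, C]" for Y
    using card_conj_orbit_dvd_order[OF fin sub(1)[OF that]] .
  have "5 dvd order G" using dvd_n[OF X(1)] X(2) by simp
  moreover have "\<not> 5 ^ 2 dvd order G" using n60 by (auto dest: dvd_trans)
  ultimately obtain Y d where Y: "Y \<in> set [A, B, C]" "d dvd ?m Y" "d mod 5 = 1" "d \<ge> 5"
    using cover_prime_divisor[of 5 "[A, B, C]"] set cov by auto
  have "d \<le> 10" using dvd_imp_le[OF Y(2)] le10[OF Y(1)] sub(3)[OF Y(1)] by simp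
  then have d6: "d = 6" using Y(3,4) by presburger
  obtain k where "?m Y = 6 * k" using Y(2) d6 by (auto simp: dvd_def)
  then have m6: "?m Y = 6" using le10[OF Y(1)] sub(3)[OF Y(1)] by (cases k) auto
  have "3 dvd order G" using dvd_n[OF Y(1)] m6 by (auto intro: dvd_trans[of 3 6])
  moreover have "\<not> 3 ^ 2 dvd order G" using n60 by (auto dest: dvd_trans)
  ultimately obtain Z d' where Z: "Z \<in> set [A, B, C]" "d' dvd ?m Z" "d' mod 3 = 1" "d' \<ge> 5"
    using cover_prime_divisor[of 3 "[A, B, C]"] set cov by auto
  have "d' \<le> 10" using dvd_imp_le[OF Z(2)] le10[OF Z(1)] sub(3)[OF Z(1)] by simp
  then have "d' = 7 \<or> d' = 10" using Z(3,4) by presburger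
  moreover have "d' dvd 60" using Z(2) dvd_n[OF Z(1)] n60 by (blast intro: dvd_trans)
  ultimately have d10: "d' = 10" by auto
  then have m10: "?m Z = 10"
    using dvd_imp_le[OF Z(2)] le10[OF Z(1)] sub(3)[OF Z(1)] by simp
  show False using X Y(1) Z(1) m6 m10 le ge' by auto
qed

theorem cover_card_ge_21: "card \<A> \<ge> 21"
proof (rule ccontr)
  assume "\<not> card \<A> \<ge> 21"
  then have le20: "card \<A> \<le> 20" by simp
  have "\<A> \<subseteq> Pow (carrier G)" using cover_subset by auto
  then obtain As where As: "set As \<subseteq> \<A>" "\<A> = (\<Union>A\<in>set As. conjugates A)"
    "card \<A> = (\<Sum>A\<leftarrow>As. card (conjugates A))"
    using conj_invariant_representatives[OF finite_cover] cover_conj by blast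
  have "5 * length Bs \<le> (\<Sum>A\<leftarrow>Bs. card (conjugates A))" if "set Bs \<subseteq> \<A>" for Bs
    using that by (induction Bs) (use cover_orbit_ge_5 in fastforce)+
  then have "5 * length As \<le> 20" using As le20 by fastforce
  then have "length As \<le> 4" by simp
  then have "length As = 0 \<or> length As = Suc 0 \<or> length As = Suc (Suc 0) \<or> length As = Suc (Suc (Suc 0))
    \<or> length As = Suc (Suc (Suc (Suc 0)))" by presburger
  then consider "As = []" | A where "As = [A]" | A B where "As = [A, B]" | A B C where "As = [A, B, C]"
    | A B C D where "As = [A, B, C, D]"
    by (auto simp: length_Suc_conv)
  then show False
  proof cases
    case 1
    then have "\<A> = {}" using As(2) by simp
    then show False using cover simple_not_triv one_closed by blast
  next
    case (2 A)
    then have A: "A \<in> \<A>" using As(1) by simp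
    \<comment> \<open>A finite group is not the union of the conjugates of a proper subgroup: they
      share the identity, so they cover too little.\<close>
    have "order G \<le> 1 + card (conjugates A) * (card A - 1)"
      using order_le_sum[OF As(1,2)] 2 by simp
    moreover have "card (conjugates A) * card A \<le> order G"
      using dvd_imp_le[OF cover_card_dvd[OF A]] order_gt_one by simp
    moreover have "card (conjugates A) \<le> card (conjugates A) * card A" using cover_card_ge_2[OF A] by simp
    moreover have "card (conjugates A) * (card A - 1) = card (conjugates A) * card A - card (conjugates A)"
      by (simp add: diff_mult_distrib2)
    ultimately show False using cover_orbit_ge_5[OF A] by linarith
  next
    case (3 A B)
    then show False using not_two_orbits[of A B] As le20 by simp
  next
    case (4 A B C)
    show False
    proof (cases "\<exists>X\<in>set [A, B, C]. card (conjugates X) = 5")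
      case True
      then show False using not_three_orbits_5[of A B C] As le20 4 by auto
    next
      case False
      have "card (conjugates X) \<ge> 6" if "X \<in> set [A, B, C]" for X
        using that False cover_orbit_ge_5[of X] As(1) 4 by fastforce
      then show False using not_three_orbits_ge_6[of A B C] As le20 4 by auto
    qed
  next
    \<comment> \<open>All four sizes must equal 5. Then the order divides 60, and the prime 5 would
      require a divisor of 5 that is at least 5 and congruent to 1 modulo 5.\<close>
    case (5 A B C D)
    have "card (conjugates A) \<ge> 5" "card (conjugates B) \<ge> 5" "card (conjugates C) \<ge> 5" "card (conjugates D) \<ge> 5"
      using cover_orbit_ge_5 As(1) 5 by auto
    moreover have "card (conjugates A) + card (conjugates B) + card (conjugates C) + card (conjugates D) \<le> 20"
      using As(3) le20 5 by simp
    ultimately have "card (conjugates A) = 5" "card (conjugates B) = 5" "card (conjugates C) = 5" "card (conjugates D) = 5"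
      by linarith+
    then have five: "card (conjugates X) = 5" if "X \<in> set As" for X
      using that 5 by auto
    have Ac: "A \<subseteq> carrier G" using As(1) 5 cover_subset by auto
    have "2 * order G dvd fact 5"
      using order_dvd_fact_conjugates[OF Ac] five[of A] 5 by simp
    also have "fact 5 = 2 * (60::nat)" by (simp add: fact_numeral)
    finally have n60: "order G dvd 60" by simp
    have "5 dvd order G" using card_conj_orbit_dvd_order[OF fin Ac] five[of A] 5 by simp
    moreover have "\<not> 5 ^ 2 dvd order G" using n60 by (auto dest: dvd_trans)
    ultimately obtain d :: nat where d: "d dvd 5" "d mod 5 = 1" "d \<ge> 5"
      using cover_prime_divisor[of 5 As] As(1,2) five by auto
    have "d \<le> 5" using d(1) by (auto dest: dvd_imp_le)
    then show False using d by simp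
  qed
qed

end

section \<open>Reduction to simple groups\<close>

text \<open>For a normal subgroup \<open>N\<close> of the quotient, \<open>\<Union>N\<close> is its
  preimage, a normal subgroup containing \<open>H\<close>, to which maximality applies.\<close>

lemma (in normal) quotient_simple:
  assumes fin: "finite (carrier G)" and ne: "H \<noteq> carrier G"
    and max: "\<And>N. \<lbrakk>N \<lhd> G; H \<subseteq> N\<rbrakk> \<Longrightarrow> N = H \<or> N = carrier G"
  shows "simple_group (G Mod H)"
proof (intro simple_group.intro simple_group_axioms.intro factorgroup_is_group)
  interpret F: group "G Mod H" by (rule factorgroup_is_group)
  have "finite (carrier (G Mod H))" using fin by (simp add: carrier_FactGroup)
  moreover have "order (G Mod H) \<noteq> 1" using fact_group_trivial_iff[OF fin] ne F.order_one_triv_iff by simp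
  ultimately show "1 < order (G Mod H)" using F.order_gt_0_iff_finite by linarith
  fix N assume N: "N \<lhd> G Mod H"
  have sN: "subgroup N (G Mod H)" using N by (rule normal_imp_subgroup)
  have U: "\<Union>N = {x \<in> carrier G. H #> x \<in> N}" by (rule factgroup_subgroup_union_char[OF sN])
  have "H \<in> N" using subgroup.one_closed[OF sN] by simp
  then have "H \<subseteq> \<Union>N" by blast
  then have "\<Union>N = H \<or> \<Union>N = carrier G" using max factgroup_subgroup_union_normal[OF N] by blast
  then show "N = carrier (G Mod H) \<or> N = {\<one>\<^bsub>G Mod H\<^esub>}"
  proof
    assume H: "\<Union>N = H"
    have "X = H" if X: "X \<in> N" for X
    proof -
      obtain x where x: "x \<in> carrier G" "X = H #> x"
        using subgroup.mem_carrier[OF sN X] by (auto simp: carrier_FactGroup)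
      then have "x \<in> H" using U H X by blast
      then show ?thesis using rcos_const x(2) by simp
    qed
    then have "N = {H}" using \<open>H \<in> N\<close> by blast
    then show ?thesis by simp
  next
    assume "\<Union>N = carrier G"
    then have "carrier (G Mod H) \<subseteq> N" using U by (auto simp: carrier_FactGroup)
    then show ?thesis using subgroup.subset[OF sN] by blast
  qed
qed

lemma (in group) maximal_normal_subgroup_exists:
  assumes "finite (carrier G)" "carrier G \<noteq> {\<one>}"
  shows "\<exists>R. R \<lhd> G \<and> R \<noteq> carrier G \<and> (\<forall>N. N \<lhd> G \<longrightarrow> R \<subseteq> N \<longrightarrow> N = R \<or> N = carrier G)"
proof -
  let ?X = "{R. R \<lhd> G \<and> R \<noteq> carrier G}"
  have "?X \<subseteq> Pow (carrier G)" using normal_imp_subgroup subgroup.subset by blast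
  then have "finite ?X" using assms(1) finite_subset by auto
  moreover have "?X \<noteq> {}" using one_is_normal assms(2) by blast
  ultimately obtain R where "R \<in> ?X" "\<forall>N\<in>?X. R \<subseteq> N \<longrightarrow> R = N"
    using finite_has_maximal[of ?X] by blast
  then show ?thesis by blast
qed

lemma (in group_hom) img_conj_set:
  assumes "g \<in> carrier G" "A \<subseteq> carrier G"
  shows "h ` G.conj_set g A = H.conj_set (h g) (h ` A)"
proof -
  have "h (g \<otimes> x \<otimes> inv g) = h g \<otimes>\<^bsub>H\<^esub> h x \<otimes>\<^bsub>H\<^esub> inv\<^bsub>H\<^esub> h g" if "x \<in> A" for x
  proof -
    have "x \<in> carrier G" using that assms by auto
    then show ?thesis using assms(1) by simp
  qed
  then show ?thesis by (simp add: G.conj_set_def H.conj_set_def image_image cong: image_cong)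
qed

context group
begin

section \<open>Centres of centralizers and the passage to a simple section\<close>

definition centre_of :: "'a set \<Rightarrow> 'a set" where
  "centre_of C = {y \<in> C. \<forall>c\<in>C. y \<otimes> c = c \<otimes> y}"

lemma centralizer_subgroup:
  assumes "x \<in> carrier G" shows "subgroup (centralizer G x) G"
proof -
  have "centralizer G x = conj_stab (carrier G) {x}"
    using assms inv_solve_right' by (auto simp: centralizer_def conj_stab_def conj_set_def)
  then show ?thesis using conj_stab_subgroup[OF subgroup_self, of "{x}"] assms by simp
qed

lemma centre_of_subgroup:
  assumes "subgroup C G" shows "subgroup (centre_of C) G"
proof -
  have Cc: "C \<subseteq> carrier G" using assms subgroup.subset by auto
  have "centre_of C = C \<inter> \<Inter> ((\<lambda>x. centralizer G x) ` C)"
    using Cc by (auto simp: centre_of_def centralizer_def)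
  also have "\<dots> = \<Inter> (insert C ((\<lambda>x. centralizer G x) ` C))" by simp
  also have "subgroup \<dots> G"
    using assms centralizer_subgroup Cc by (intro subgroups_Inter) auto
  finally show ?thesis .
qed

text \<open>One inclusion, proved for all group elements, yields the other when it is applied to
  \<open>inv g\<close>.\<close>

lemma conj_set_centralizer:
  assumes "g \<in> carrier G" "x \<in> carrier G"
  shows "conj_set g (centralizer G x) = centralizer G (g \<otimes> x \<otimes> inv g)"
proof -
  have *: "conj_set k (centralizer G y) \<subseteq> centralizer G (k \<otimes> y \<otimes> inv k)"
    if k: "k \<in> carrier G" and y: "y \<in> carrier G" for k y
  proof
    fix z assume "z \<in> conj_set k (centralizer G y)"
    then obtain c where c: "c \<in> carrier G" "c \<otimes> y = y \<otimes> c" "z = k \<otimes> c \<otimes> inv k"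
      by (auto simp: conj_set_def centralizer_def)
    have *: "(k \<otimes> a \<otimes> inv k) \<otimes> (k \<otimes> b \<otimes> inv k) = k \<otimes> (a \<otimes> b) \<otimes> inv k"
      if "a \<in> carrier G" "b \<in> carrier G" for a b
    proof -
      have "inv k \<otimes> (k \<otimes> (b \<otimes> inv k)) = b \<otimes> inv k"
        using k that by (simp add: m_assoc[symmetric])
      then show ?thesis using k that by (simp add: m_assoc)
    qed
    show "z \<in> centralizer G (k \<otimes> y \<otimes> inv k)"
      using c k y *[OF c(1) y] *[OF y c(1)] by (simp add: centralizer_def)
  qed
  have gx: "g \<otimes> x \<otimes> inv g \<in> carrier G" using assms by simp
  have "inv g \<otimes> (g \<otimes> x \<otimes> inv g) \<otimes> inv (inv g) = x"
    using conj_elem_mult[of "inv g" g x] assms by simp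
  then have "conj_set (inv g) (centralizer G (g \<otimes> x \<otimes> inv g)) \<subseteq> centralizer G x"
    using *[OF inv_closed[OF assms(1)] gx] by simp
  then have "conj_set g (conj_set (inv g) (centralizer G (g \<otimes> x \<otimes> inv g))) \<subseteq> conj_set g (centralizer G x)"
    by (rule conj_set_mono)
  then show ?thesis
    using *[OF assms] conj_set_inv(2)[OF assms(1), of "centralizer G (g \<otimes> x \<otimes> inv g)"]
    by (auto simp: centralizer_def)
qed

lemma conj_set_centre_of:
  assumes g: "g \<in> carrier G" and C: "C \<subseteq> carrier G"
  shows "conj_set g (centre_of C) = centre_of (conj_set g C)"
proof -
  have mult: "(k \<otimes> a \<otimes> inv k) \<otimes> (k \<otimes> b \<otimes> inv k) = k \<otimes> (a \<otimes> b) \<otimes> inv k"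
    if "a \<in> carrier G" "b \<in> carrier G" "k \<in> carrier G" for a b k
  proof -
    have "inv k \<otimes> (k \<otimes> (b \<otimes> inv k)) = b \<otimes> inv k"
      using that by (simp add: m_assoc[symmetric])
    then show ?thesis using that by (simp add: m_assoc)
  qed
  have *: "conj_set k (centre_of D) \<subseteq> centre_of (conj_set k D)" if "k \<in> carrier G" "D \<subseteq> carrier G" for k D
  proof
    fix z assume "z \<in> conj_set k (centre_of D)"
    then obtain y where y: "y \<in> D" "\<forall>c\<in>D. y \<otimes> c = c \<otimes> y" "z = k \<otimes> y \<otimes> inv k"
      by (auto simp: conj_set_def centre_of_def)
    show "z \<in> centre_of (conj_set k D)"
      using y that mult by (auto simp: centre_of_def conj_set_def subset_iff)
  qed
  have gC: "conj_set g C \<subseteq> carrier G" using conj_set_closed[OF g C] .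
  have "conj_set (inv g) (centre_of (conj_set g C)) \<subseteq> centre_of C"
    using *[OF inv_closed[OF g] gC] conj_set_inv(1)[OF g C] by simp
  then have "conj_set g (conj_set (inv g) (centre_of (conj_set g C))) \<subseteq> conj_set g (centre_of C)"
    by (rule conj_set_mono)
  moreover have "centre_of (conj_set g C) \<subseteq> carrier G" using gC by (auto simp: centre_of_def)
  ultimately show ?thesis using *[OF g C] conj_set_inv(2)[OF g] by auto
qed

lemma centralizers_conj_closed:
  assumes "C \<in> centralizers G - {carrier G}" "g \<in> carrier G"
  shows "conj_set g C \<in> centralizers G - {carrier G}"
proof -
  obtain x where x: "x \<in> carrier G" "C = centralizer G x" using assms(1) by (auto simp: centralizers_def)
  have Cc: "C \<subseteq> carrier G" using x by (auto simp: centralizer_def)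
  have "conj_set g C \<noteq> carrier G"
  proof
    assume "conj_set g C = carrier G"
    then have "C = conj_set (inv g) (carrier G)" using conj_set_inv(1)[OF assms(2) Cc] by simp
    also have "\<dots> = carrier G"
      using subgroup_subset_conj_stab[OF subgroup_self] assms(2) by (auto simp: conj_stab_def)
    finally show False using assms(1) by simp
  qed
  then show ?thesis
    using x conj_set_centralizer[OF assms(2) x(1)] assms(2) by (auto simp: centralizers_def)
qed

text \<open>A non-central \<open>x\<close> lies in the centre of its own centralizer. A central
  \<open>x\<close> lies in the centre of any proper centralizer, and one exists because the group is
  not commutative; so leaving out \<open>carrier G\<close> loses nothing.\<close>

lemma centre_of_centralizers_cover:
  assumes "\<not> comm_group G" "x \<in> carrier G"
  shows "\<exists>C \<in> centralizers G - {carrier G}. x \<in> centre_of C"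
proof (cases "centralizer G x = carrier G")
  case False
  then show ?thesis
    using assms(2) by (intro bexI[of _ "centralizer G x"]) (auto simp: centre_of_def centralizer_def centralizers_def)
next
  case True
  obtain y where y: "y \<in> carrier G" "centralizer G y \<noteq> carrier G"
  proof -
    have "\<exists>y\<in>carrier G. centralizer G y \<noteq> carrier G"
    proof (rule ccontr)
      assume "\<not> ?thesis"
      then have "a \<otimes> b = b \<otimes> a" if "a \<in> carrier G" "b \<in> carrier G" for a b
        using that by (auto simp: centralizer_def)
      then show False using assms(1) group_comm_groupI by blast
    qed
    then show ?thesis using that by blast
  qed
  have "x \<otimes> c = c \<otimes> x" if "c \<in> carrier G" for c
  proof -
    have "c \<in> centralizer G x" using True that by simp
    then show ?thesis by (simp add: centralizer_def)
  qed
  then show ?thesis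
    using y assms(2) by (intro bexI[of _ "centralizer G y"]) (auto simp: centre_of_def centralizer_def centralizers_def)
qed

text \<open>Take a non-soluble subgroup \<open>H\<close> of least order and a maximal normal
  subgroup \<open>R\<close> of it. By minimality \<open>R\<close> is soluble, so \<open>H\<close>
  modulo \<open>R\<close> is not commutative, and it is simple by maximality. Intersecting the
  centres with \<open>H\<close> and projecting does not increase their number.\<close>

lemma centralizers_card_ge_22:
  assumes fin: "finite (carrier G)" and "\<not> solvable G"
  shows "card (centralizers G) \<ge> 22"
proof -
  define \<Z> where "\<Z> = centre_of ` (centralizers G - {carrier G})"
  have finC: "finite (centralizers G)" using fin by (simp add: centralizers_def)
  have "carrier G = centralizer G \<one>" by (auto simp: centralizer_def)
  then have "carrier G \<in> centralizers G" by (auto simp: centralizers_def)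
  then have cZ: "card \<Z> + 1 \<le> card (centralizers G)"
    unfolding \<Z>_def using card_image_le[of "centralizers G - {carrier G}" centre_of] finC
      card_Suc_Diff1[OF finC] by fastforce
  have finZ: "finite \<Z>" using finC by (simp add: \<Z>_def)
  have Zsub: "subgroup A G" if "A \<in> \<Z>" for A
    using that centralizer_subgroup centre_of_subgroup by (auto simp: \<Z>_def centralizers_def)
  have Zcomm: "x \<otimes> y = y \<otimes> x" if "A \<in> \<Z>" "x \<in> A" "y \<in> A" for A x y
    using that by (auto simp: \<Z>_def centre_of_def)
  have Zconj: "conj_set g A \<in> \<Z>" if A: "A \<in> \<Z>" "g \<in> carrier G" for A g
  proof -
    obtain C where C: "C \<in> centralizers G - {carrier G}" "A = centre_of C"
      using A(1) unfolding \<Z>_def by blast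
    have "C \<subseteq> carrier G" using C(1) by (auto simp: centralizers_def centralizer_def)
    then show ?thesis
      using C conj_set_centre_of[OF A(2)] centralizers_conj_closed[OF C(1) A(2)] by (auto simp: \<Z>_def)
  qed
  have nc: "\<not> comm_group G"
  proof
    assume c: "comm_group G"
    have "comm_group ((G\<lparr>carrier := carrier G\<rparr>) Mod {\<one>})"
      using comm_group.abelian_FactGroup[OF c triv_subgroup] by simp
    then have "solvable G"
      unfolding solvable_def
      using solvable_seq.extension[OF solvable_seq.unity, of G "carrier G"] one_is_normal subgroup_self by simp
    then show False using assms(2) by simp
  qed
  have Zcov: "\<exists>A\<in>\<Z>. x \<in> A" if "x \<in> carrier G" for x
    using centre_of_centralizers_cover[OF nc that] by (auto simp: \<Z>_def)
  have "\<exists>H. (subgroup H G \<and> \<not> solvable_seq G H) \<and> (\<forall>K. subgroup K G \<and> \<not> solvable_seq G K \<longrightarrow> card H \<le> card K)"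
    using subgroup_self assms(2)
    by (intro ex_has_least_nat[of _ "carrier G"]) (simp add: solvable_def)
  then obtain H where H: "subgroup H G" "\<not> solvable_seq G H"
    and Hmin: "\<And>K. \<lbrakk>subgroup K G; \<not> solvable_seq G K\<rbrakk> \<Longrightarrow> card H \<le> card K" by blast
  have Hc: "H \<subseteq> carrier G" using subgroup.subset[OF H(1)] .
  have finH: "finite H" using Hc fin finite_subset by auto
  define K where "K = G\<lparr>carrier := H\<rparr>"
  interpret K: group K unfolding K_def by (rule subgroup_imp_group[OF H(1)])
  have Kc: "carrier K = H" by (simp add: K_def)
  have "carrier K \<noteq> {\<one>\<^bsub>K\<^esub>}" using H(2) solvable_seq.unity[of G] by (auto simp: K_def)
  then obtain R where R: "R \<lhd> K" "R \<noteq> carrier K" "\<And>N. \<lbrakk>N \<lhd> K; R \<subseteq> N\<rbrakk> \<Longrightarrow> N = R \<or> N = carrier K"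
    using K.maximal_normal_subgroup_exists finH Kc by auto
  interpret R: normal R K by fact
  let ?S = "K Mod R"
  have sRG: "subgroup R G" using incl_subgroup[OF H(1)] R.subgroup_axioms by (simp add: K_def)
  have "card R < card H" using R(2) R.subset finH Kc by (simp add: psubset_card_mono psubset_eq)
  then have solR: "solvable_seq G R" using Hmin[OF sRG] by fastforce
  have "\<not> comm_group ?S"
    using solvable_seq.extension[OF solR _ H(1)] R(1) H(2) by (auto simp: K_def)
  moreover have "simple_group ?S" using R.quotient_simple[OF _ R(2,3)] finH Kc by simp
  moreover have finS: "finite (carrier ?S)" using finH by (simp add: carrier_FactGroup Kc)
  ultimately interpret S: nonabelian_simple_group ?S
    by (simp add: nonabelian_simple_group_def nonabelian_simple_group_axioms_def)
  define \<phi> where "\<phi> = (\<lambda>y. R #>\<^bsub>K\<^esub> y)"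
  interpret \<phi>: group_hom K ?S \<phi>
    unfolding \<phi>_def using R.r_coset_hom_Mod by (simp add: group_hom_def group_hom_axioms_def K.is_group S.is_group)
  \<comment> \<open>Centres that meet \<open>H\<close> inside \<open>R\<close> become trivial and
    are discarded; this can only lower the count.\<close>
  define \<A> where "\<A> = (\<lambda>A. \<phi> ` (A \<inter> H)) ` \<Z> - {{\<one>\<^bsub>?S\<^esub>}}"
  have AH: "subgroup (A \<inter> H) K" if "A \<in> \<Z>" for A
    unfolding K_def using subgroup_incl[OF subgroups_Inter_pair[OF Zsub[OF that] H(1)] H(1)] by simp
  have "abelian_cover ?S \<A>"
  proof (intro abelian_cover.intro abelian_cover_axioms.intro)
    show "nonabelian_simple_group ?S" by (rule S.nonabelian_simple_group_axioms)
  next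
    fix X assume X: "X \<in> \<A>"
    then obtain A where A: "A \<in> \<Z>" "X = \<phi> ` (A \<inter> H)" by (auto simp: \<A>_def)
    show sX: "subgroup X ?S" using \<phi>.subgroup_img_is_subgroup[OF AH[OF A(1)]] A(2) by simp
    show "X \<noteq> {\<one>\<^bsub>?S\<^esub>}" using X by (simp add: \<A>_def)
    show "x \<otimes>\<^bsub>?S\<^esub> y = y \<otimes>\<^bsub>?S\<^esub> x" if xy: "x \<in> X" "y \<in> X" for x y
    proof -
      obtain a b where ab: "a \<in> A \<inter> H" "x = \<phi> a" "b \<in> A \<inter> H" "y = \<phi> b" using xy A(2) by auto
      have "a \<otimes>\<^bsub>K\<^esub> b = b \<otimes>\<^bsub>K\<^esub> a" using Zcomm[OF A(1)] ab by (simp add: K_def)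
      moreover have "a \<in> carrier K" "b \<in> carrier K" using ab Kc by auto
      ultimately show ?thesis using ab(2,4) by (metis \<phi>.hom_mult)
    qed
    show "S.conj_set g X \<in> \<A>" if g: "g \<in> carrier ?S" for g
    proof -
      \<comment> \<open>Invariance is inherited by lifting \<open>g\<close> to an element of
        \<open>H\<close>, which normalizes \<open>H\<close> and permutes the centres.\<close>
      obtain h where h: "h \<in> H" "g = \<phi> h" using g by (auto simp: carrier_FactGroup Kc \<phi>_def)
      have hc: "h \<in> carrier G" using h Hc by auto
      have "K.conj_set h (A \<inter> H) = conj_set h (A \<inter> H)"
        unfolding K.conj_set_def conj_set_def using m_inv_consistent[OF H(1) h(1)] by (simp add: K_def)
      also have "\<dots> = conj_set h A \<inter> conj_set h H"
        using conj_set_Int[OF hc] Zsub[OF A(1)] subgroup.subset Hc by blast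
      also have "conj_set h H = H"
        using subgroup_subset_conj_stab[OF H(1)] h(1) by (auto simp: conj_stab_def)
      finally have "\<phi> ` (conj_set h A \<inter> H) = S.conj_set g X"
        using \<phi>.img_conj_set[of h "A \<inter> H"] h A(2) Kc by simp
      then have "S.conj_set g X \<in> (\<lambda>A. \<phi> ` (A \<inter> H)) ` \<Z>" using Zconj[OF A(1) hc] by blast
      moreover have "S.conj_set g X \<noteq> {\<one>\<^bsub>?S\<^esub>}"
      proof
        assume "S.conj_set g X = {\<one>\<^bsub>?S\<^esub>}"
        then have "X = S.conj_set (inv\<^bsub>?S\<^esub> g) {\<one>\<^bsub>?S\<^esub>}"
          using S.conj_set_inv(1)[OF g subgroup.subset[OF sX]] by simp
        then have "X = {\<one>\<^bsub>?S\<^esub>}" using S.conj_set_trivial[OF S.inv_closed[OF g]] by simp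
        then show False using X by (simp add: \<A>_def)
      qed
      ultimately show ?thesis by (simp add: \<A>_def)
    qed
  next
    fix x assume x: "x \<in> carrier ?S" "x \<noteq> \<one>\<^bsub>?S\<^esub>"
    obtain h where h: "h \<in> H" "x = \<phi> h" using x(1) by (auto simp: carrier_FactGroup Kc \<phi>_def)
    then obtain A where A: "A \<in> \<Z>" "h \<in> A" using Zcov Hc by blast
    then have xA: "x \<in> \<phi> ` (A \<inter> H)" using h by blast
    then have "\<phi> ` (A \<inter> H) \<noteq> {\<one>\<^bsub>?S\<^esub>}" using x(2) by blast
    then have "\<phi> ` (A \<inter> H) \<in> \<A>" unfolding \<A>_def using imageI[OF A(1)] by simp
    then show "\<exists>X\<in>\<A>. x \<in> X" using xA by (rule bexI[rotated])
  qed
  then have "21 \<le> card \<A>" by (rule abelian_cover.cover_card_ge_21)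
  also have "\<dots> \<le> card ((\<lambda>A. \<phi> ` (A \<inter> H)) ` \<Z>)" unfolding \<A>_def using finZ by (intro card_mono) auto
  also have "\<dots> \<le> card \<Z>" using finZ by (rule card_image_le)
  finally show ?thesis using cZ by linarith
qed

end

section \<open>The centralizers of \<open>A\<^sub>5\<close>\<close>

text \<open>Equality of functions on \<open>nat\<close> cannot be decided by evaluation. A
  permutation of five points is therefore encoded as the list of its images, over a type with
  exactly five elements.\<close>

datatype five = F1 | F2 | F3 | F4 | F5

datatype table = Table five five five five five

fun apply_table :: "table \<Rightarrow> five \<Rightarrow> five" where
  "apply_table (Table a b c d e) F1 = a"
| "apply_table (Table a b c d e) F2 = b"
| "apply_table (Table a b c d e) F3 = c"
| "apply_table (Table a b c d e) F4 = d"
| "apply_table (Table a b c d e) F5 = e"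

fun compose_table :: "table \<Rightarrow> table \<Rightarrow> table" where
  "compose_table t (Table a b c d e) =
     Table (apply_table t a) (apply_table t b) (apply_table t c) (apply_table t d) (apply_table t e)"

text \<open>The default \<open>F5\<close> is meant for the argument 5; injectivity is only claimed
  on \<open>{1..5}\<close>.\<close>

definition five_of :: "nat \<Rightarrow> five" where
  "five_of i = (if i = 1 then F1 else if i = 2 then F2 else if i = 3 then F3 else if i = 4 then F4 else F5)"

definition table_of :: "(nat \<Rightarrow> nat) \<Rightarrow> table" where
  "table_of p = Table (five_of (p 1)) (five_of (p 2)) (five_of (p 3)) (five_of (p 4)) (five_of (p 5))"

text \<open>The factorization \<open>A\<^sub>5 = C\<^sub>5 C\<^sub>3 V\<^sub>4\<close>: a transitive cyclic group times the stabilizer of a point.\<close>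

definition alt5_tables :: "table list" where
  "alt5_tables = [compose_table s (compose_table t u).
     s \<leftarrow> [Table F1 F2 F3 F4 F5, Table F2 F3 F4 F5 F1, Table F3 F4 F5 F1 F2, Table F4 F5 F1 F2 F3, Table F5 F1 F2 F3 F4],
     t \<leftarrow> [Table F1 F2 F3 F4 F5, Table F2 F3 F1 F4 F5, Table F3 F1 F2 F4 F5],
     u \<leftarrow> [Table F1 F2 F3 F4 F5, Table F2 F1 F4 F3 F5, Table F3 F4 F1 F2 F5, Table F4 F3 F2 F1 F5]]"

lemma distinct_alt5_tables: "length (remdups alt5_tables) = 60"
  by code_simp

lemma alt5_table_centralizers:
  "length (remdups (map (\<lambda>s. filter (\<lambda>t. compose_table t s = compose_table s t) alt5_tables) alt5_tables)) = 22"
  by code_simp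

lemma table_of_compose:
  assumes "q permutes {1..5}"
  shows "table_of (p \<circ> q) = compose_table (table_of p) (table_of q)"
proof -
  have "five_of (p i) = apply_table (table_of p) (five_of i)" if "i \<in> {1..5}" for i
  proof -
    have "i = 1 \<or> i = 2 \<or> i = 3 \<or> i = 4 \<or> i = 5" using that by (simp; presburger)
    then show ?thesis by (auto simp: table_of_def five_of_def)
  qed
  moreover have "q i \<in> {1..5}" if "i \<in> {1..5}" for i using permutes_in_image[OF assms] that by blast
  ultimately show ?thesis by (simp add: table_of_def[of "p \<circ> q"] table_of_def[of q])
qed

lemma inj_on_table_of: "inj_on table_of {p. p permutes {1..5}}"
proof (rule inj_onI)
  fix p q assume pq: "p \<in> {p. p permutes {1..5}}" "q \<in> {p. p permutes {1..5}}" "table_of p = table_of q"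
  show "p = q"
  proof
    fix i :: nat
    show "p i = q i"
    proof (cases "i \<in> {1..5}")
      case True
      then have "i = 1 \<or> i = 2 \<or> i = 3 \<or> i = 4 \<or> i = 5" by (simp; presburger)
      then have "five_of (p i) = five_of (q i)" using pq(3) by (auto simp: table_of_def)
      moreover have "p i \<in> {1..5}" "q i \<in> {1..5}"
        using pq(1,2) True permutes_in_image[of p "{1..5}" i] permutes_in_image[of q "{1..5}" i] by auto
      moreover have "inj_on five_of {1..5}" 
        by (rule inj_onI) (auto simp: five_of_def split: if_splits)
      ultimately show ?thesis by (meson inj_onD)
    next
      case False
      then show ?thesis using pq(1,2) by (auto simp: permutes_def)
    qed
  qed
qed

text \<open>The tables of even permutations are closed under composition and contain the factors
  from which \<open>alt5_tables\<close> is built. The 60 distinct products then exhaust them, since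
  the group has order 60.\<close>

lemma table_of_alt5: "table_of ` carrier (alt_group 5) = set alt5_tables"
proof -
  let ?X = "table_of ` carrier (alt_group 5)"
  interpret A: group "alt_group 5" by (rule alt_group_is_group)
  have comp: "compose_table s t \<in> ?X" if st: "s \<in> ?X" "t \<in> ?X" for s t
  proof -
    obtain p q where pq: "p \<in> carrier (alt_group 5)" "s = table_of p" "q \<in> carrier (alt_group 5)" "t = table_of q"
      using st by blast
    then have "compose_table s t = table_of (p \<otimes>\<^bsub>alt_group 5\<^esub> q)"
      using table_of_compose[of q p] by (simp add: alt_group_mult alt_group_carrier)
    then show ?thesis using A.m_closed[OF pq(1,3)] by blast
  qed
  have cyc: "table_of (cycle_of_list [a, b, c]) \<in> ?X" if "distinct [a, b, c]" "{a, b, c} \<subseteq> {1..5}" for a b c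
  proof (rule imageI)
    have "cycle_of_list [a, b, c] \<in> three_cycles 5" using that
      by (intro CollectI exI[of _ "[a, b, c]"]) simp
    then show "cycle_of_list [a, b, c] \<in> carrier (alt_group 5)" using three_cycles_incl by blast
  qed
  \<comment> \<open>These 3-cycles are chosen for their products: (1 2 3)(3 4 5) is the 5-cycle, and
    (1 2 3)(2 3 4) and (1 3 2)(3 2 4) are double transpositions generating the Klein
    four-group.\<close>
  have "table_of (cycle_of_list [1, 2, 3]) = Table F2 F3 F1 F4 F5"
    by (simp add: table_of_def five_of_def transpose_def)
  then have 1: "Table F2 F3 F1 F4 F5 \<in> ?X" using cyc[of 1 2 3] by simp
  have "table_of (cycle_of_list [3, 4, 5]) = Table F1 F2 F4 F5 F3"
    by (simp add: table_of_def five_of_def transpose_def)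
  then have 2: "Table F1 F2 F4 F5 F3 \<in> ?X" using cyc[of 3 4 5] by simp
  have "table_of (cycle_of_list [2, 3, 4]) = Table F1 F3 F4 F2 F5"
    by (simp add: table_of_def five_of_def transpose_def)
  then have 3: "Table F1 F3 F4 F2 F5 \<in> ?X" using cyc[of 2 3 4] by simp
  have "table_of (cycle_of_list [1, 3, 2]) = Table F3 F1 F2 F4 F5"
    by (simp add: table_of_def five_of_def transpose_def)
  then have 4: "Table F3 F1 F2 F4 F5 \<in> ?X" using cyc[of 1 3 2] by simp
  have "table_of (cycle_of_list [3, 2, 4]) = Table F1 F4 F2 F3 F5"
    by (simp add: table_of_def five_of_def transpose_def)
  then have 5: "Table F1 F4 F2 F3 F5 \<in> ?X" using cyc[of 3 2 4] by simp
  have c1: "Table F2 F3 F4 F5 F1 \<in> ?X" using comp[OF 1 2] by simp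
  have c2: "Table F3 F4 F5 F1 F2 \<in> ?X" using comp[OF c1 c1] by simp
  have c3: "Table F4 F5 F1 F2 F3 \<in> ?X" using comp[OF c1 c2] by simp
  have c4: "Table F5 F1 F2 F3 F4 \<in> ?X" using comp[OF c1 c3] by simp
  have c0: "Table F1 F2 F3 F4 F5 \<in> ?X" using comp[OF c1 c4] by simp
  have v1: "Table F2 F1 F4 F3 F5 \<in> ?X" using comp[OF 1 3] by simp
  have v2: "Table F3 F4 F1 F2 F5 \<in> ?X" using comp[OF 4 5] by simp
  have v3: "Table F4 F3 F2 F1 F5 \<in> ?X" using comp[OF v1 v2] by simp
  \<comment> \<open>The products must stay unevaluated for the closure rule \<open>comp\<close> to
    match them.\<close>
  have "set alt5_tables \<subseteq> ?X"
    unfolding alt5_tables_def using c0 c1 c2 c3 c4 1 4 v1 v2 v3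
    by (auto simp del: compose_table.simps intro!: comp)
  moreover have "card (set alt5_tables) = 60"
    using distinct_alt5_tables by (simp add: length_remdups_card_conv)
  moreover have "card ?X \<le> 60"
  proof -
    have "2 * card (carrier (alt_group 5)) = fact 5" by (rule alt_group_card_carrier) simp
    then have c: "card (carrier (alt_group 5)) = 60" by (simp add: fact_numeral)
    then have "finite (carrier (alt_group 5))" by (metis card.infinite zero_neq_numeral)
    then show ?thesis using card_image_le c by metis
  qed
  moreover have "finite ?X"
    using finite_permutations[of "{1..5::nat}"] by (auto simp: alt_group_def intro: finite_subset)
  ultimately show ?thesis by (metis card_seteq)
qed

lemma card_centralizers_alt5_le: "card (centralizers (alt_group 5)) \<le> 22"
proof -
  let ?A = "carrier (alt_group 5)"
  let ?Z = "\<lambda>s. filter (\<lambda>t. compose_table t s = compose_table s t) alt5_tables"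
  have perm: "?A \<subseteq> {p. p permutes {1..5}}" by (auto simp: alt_group_carrier)
  have inj: "inj_on table_of ?A" using inj_on_subset[OF inj_on_table_of perm] .
  have img: "table_of ` centralizer (alt_group 5) p = set (?Z (table_of p))" if p: "p \<in> ?A" for p
  proof -
    have "q \<circ> p = p \<circ> q \<longleftrightarrow> compose_table (table_of q) (table_of p) = compose_table (table_of p) (table_of q)"
      if q: "q \<in> ?A" for q
    proof -
      have pp: "p permutes {1..5}" "q permutes {1..5}" using p q perm by auto
      then have "q \<circ> p = p \<circ> q \<longleftrightarrow> table_of (q \<circ> p) = table_of (p \<circ> q)"
        using inj_on_eq_iff[OF inj_on_table_of, of "q \<circ> p" "p \<circ> q"] by (auto intro: permutes_compose)
      then show ?thesis using pp by (simp add: table_of_compose)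
    qed
    then show ?thesis
      unfolding set_filter table_of_alt5[symmetric] by (auto simp: centralizer_def alt_group_mult)
  qed
  have "inj_on ((`) table_of) (centralizers (alt_group 5))"
    by (rule inj_on_subset[OF inj_on_image_Pow[OF inj]]) (auto simp: centralizers_def centralizer_def)
  then have "card (centralizers (alt_group 5)) = card ((`) table_of ` centralizers (alt_group 5))"
    by (simp add: card_image)
  also have "(`) table_of ` centralizers (alt_group 5) = (\<lambda>p. set (?Z (table_of p))) ` ?A"
    using img by (auto simp: centralizers_def image_image)
  also have "\<dots> = set ` set (map ?Z alt5_tables)"
    by (simp add: image_image table_of_alt5[symmetric])
  \<comment> \<open>The evaluation counts lists while centralizers are sets. An inequality is enough
    here, because the lower bound comes from non-solubility.\<close>
  also have "card \<dots> \<le> card (set (map ?Z alt5_tables))" by (rule card_image_le) simp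
  also have "\<dots> = 22" using alt5_table_centralizers by (simp only: length_remdups_card_conv)
  finally show ?thesis .
qed

theorem theoremA:
  shows "(\<forall>G :: ('a, 'b) monoid_scheme.
            group G \<and> finite (carrier G) \<and> card (centralizers G) \<le> 21 \<longrightarrow> solvable G)
         \<and> card (centralizers (alt_group 5)) = 22"
proof (intro conjI allI impI)
  fix G :: "('a, 'b) monoid_scheme"
  assume "group G \<and> finite (carrier G) \<and> card (centralizers G) \<le> 21"
  then show "solvable G" using group.centralizers_card_ge_22[of G] by fastforce
next
  have "finite (carrier (alt_group 5))"
    using finite_permutations[of "{1..5::nat}"] by (auto simp: alt_group_def intro: finite_subset)
  then have "card (centralizers (alt_group 5)) \<ge> 22"
    using group.centralizers_card_ge_22[OF alt_group_is_group] alt_group_is_unsolvable[of 5] by simp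
  then show "card (centralizers (alt_group 5)) = 22" using card_centralizers_alt5_le by simp
qed

end
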